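(* Suppose that the adversary performs a dynamic (intermittent) attack with attack fraction $\nu$. Then, w.h.p. as $t_c(i,j)\to\infty$, for all $(i,j)\in\mathcal X\times\mathcal U$, the Bellman deviation sequence has the same asymptotic limit as without dynamic attacks, $$\bar d_{i,j}\to\hat Q(i,j)-Q^*(i,j)+\gamma\,\mathbf p_{i,j}(\mathbf v-\hat{\mathbf v})^T,$$ when secure, and the slightly different limit $$\bar d_{i,j}\to\hat Q(i,j)-Q^*(i,j)+\gamma\,\mathbf p_{i,j}(\mathbf v-\hat{\mathbf v})^T+\nu\,\tilde{\mathbf p}_{i,j}(\mathbf r_{i,j}+\gamma\mathbf v)^T$$ when under attack. Similarly, the information advantage condition is modified as $$\nu\,\Phi_{\min}>2(1+\gamma)\bar\epsilon.$$ Therefore, when the information advantage condition is met, the Bellman Deviation Detection algorithm guarantees attack detection while avoiding false alarms with high probability as $t_c\to\infty$, even for dynamic attacks.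
   Context: Setting. A finite MDP $(\mathcal X,\mathcal U,\mathbf P,\mathbf R,\gamma)$ with $|\mathcal X|=N$, discount factor $\gamma\in[0,1)$; for each $(i,j)\in\mathcal X\times\mathcal U$, $\mathbf p_{i,j}$ is the row vector of transition probabilities and $\mathbf r_{i,j}$ the row vector of rewards $r_{i,j}(x')$ indexed by the next state $x'$. Observed rewards are $r_{i,j}(x')+w$ with $w$ i.i.d. zero-mean noise (finite variance is not assumed). $Q^*$ is the optimal Q-function, $V^*(x)=\max_uQ^*(x,u)$, $\mathbf v=[V^*(x_1),\dots,V^*(x_N)]$; Bellman equation: $Q^*(i,j)=\mathbf p_{i,j}(\mathbf r_{i,j}+\gamma\mathbf v)^T$. Agent. Before detection it has learned an estimate $\hat Q$ with $|\hat Q(x,u)-Q^*(x,u)|\le\epsilon(t_a)$ for all $(x,u)$ w.h.p. ($t_a$ is the training length, $\epsilon(t_a)\to0$ as $t_a\to\infty$); $\hat V(x)=\max_u\hat Q(x,u)$, $\hat{\mathbf v}=[\hat V(x_1),\dots,\hat V(x_N)]$; $\bar\epsilon\ge\epsilon(t_a)$ is an over-estimate of the agent's Q-function error. Adversary. It has a transition model $\hat{\mathbf P}$ with rows $\hat{\mathbf p}_{i,j}$; $\tilde{\mathbf p}_{i,j}=\mathbf p_{i,j}-\hat{\mathbf p}_{i,j}$. It switches intermittently between attacking and letting the agent interact with the true system: at a time step under attack the next state shown to the agent after $(i,j)$ is drawn from $\hat{\mathbf p}_{i,j}$, otherwise from $\mathbf p_{i,j}$; the agent receives the noisy reward for the transition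 shown. With $I_a(t)$ the indicator that the adversary is attacking at time $t$, the attack fraction is $\nu=\lim_{t_c\to\infty}\frac1{t_c}\sum_{t=1}^{t_c}I_a(t)$. In the secure case there is never an attack. Minimum value drift: $\Phi_{\min}=\min_{(i,j)}|\tilde{\mathbf p}_{i,j}(\mathbf r_{i,j}+\gamma\mathbf v)^T|$. Bellman Deviation Detection algorithm. Input: the detection-phase trajectory of length $t_c$. Let $t_c(i,j)$ be the number of visits to $(i,j)$, and for the $k$-th visit let $x_{i,j}(k)$ be the next state and $w_{i,j}(k)$ the noise. Put $d_{i,j}(k)=\hat Q(i,j)-r_{i,j}(x_{i,j}(k))-w_{i,j}(k)-\gamma\hat V(x_{i,j}(k))$ (the Bellman deviation sequence) and $\bar d_{i,j}=\frac1{t_c(i,j)}\sum_{k=1}^{t_c(i,j)}d_{i,j}(k)$ (its mean). Discard pairs with $t_c(i,j)\le\frac{t_c}{2|\mathcal X||\mathcal U|}$; declare a breach iff the maximum of $|\bar d_{i,j}|$ over the remaining pairs exceeds $(1+\gamma)\bar\epsilon$. "Attack detection" means declaring a breach when under attack; a "false alarm" is a breach declared when secure. For an attack active throughout detection, the "information advantage condition" is $\Phi_{\min}>2(1+\gamma)\bar\epsilon$, the condition under which this algorithm guarantees attack detection while avoiding false alarms w.h.p. as $t_c\to\infty$. An event occurs w.h.p. if its probability tends to $1$.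
   Formalization: Under attack, p becomes (1−ν)p+νp̂ in the γ(v−v̂) term (printed limit holds up to 2γνε(t_a)); the attack fraction must be ν also along visits to each pair visited forever; ε̄>0, and avoiding false alarms needs ε(t_a)<ε̄ at fixed t_a, or t_a→∞. *)

theory Defs
  imports "HOL-Probability.Probability"
begin

section \<open>The Markov decision process and its optimal Q-function\<close>

text \<open>
  States and actions are finite types.  \<open>P i j\<close> is the law of the next state after the pair
  \<open>(i, j)\<close> and \<open>R i j $ x'\<close> is the reward for the transition from \<open>(i, j)\<close> to \<open>x'\<close>.
\<close>

definition prow :: "'x::finite pmf \<Rightarrow> real ^ 'x"
  where "prow p = (\<chi> x. pmf p x)"

text \<open>A policy is randomized and may use all previous state-action pairs (oldest first).\<close>

type_synonym ('x, 'u) policy = "('x \<times> 'u) list \<Rightarrow> 'x \<Rightarrow> 'u pmf"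

text \<open>
  Law of (previous pairs, state, action) at step \<open>n\<close> when the first pair is \<open>(i, j)\<close> and
  \<open>\<pi>\<close> chooses every later action.
\<close>

primrec rollout ::
  "('x::finite \<Rightarrow> 'u::finite \<Rightarrow> 'x pmf) \<Rightarrow> ('x, 'u) policy \<Rightarrow> 'x \<Rightarrow> 'u \<Rightarrow> nat \<Rightarrow>
    (('x \<times> 'u) list \<times> 'x \<times> 'u) pmf"
where
  "rollout P \<pi> i j 0 = return_pmf ([], i, j)"
| "rollout P \<pi> i j (Suc n) =
     bind_pmf (rollout P \<pi> i j n) (\<lambda>(h, x, u).
       bind_pmf (P x u) (\<lambda>x'.
         map_pmf (\<lambda>u'. (h @ [(x, u)], x', u')) (\<pi> (h @ [(x, u)]) x')))"

definition Q_policy ::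
  "('x::finite \<Rightarrow> 'u::finite \<Rightarrow> 'x pmf) \<Rightarrow> ('x \<Rightarrow> 'u \<Rightarrow> real ^ 'x) \<Rightarrow> real \<Rightarrow>
    ('x, 'u) policy \<Rightarrow> 'x \<Rightarrow> 'u \<Rightarrow> real"
where
  "Q_policy P R \<gamma> \<pi> i j =
     (\<Sum>n. \<gamma> ^ n * measure_pmf.expectation (rollout P \<pi> i j n) (\<lambda>(h, x, u). prow (P x u) \<bullet> R x u))"

text \<open>
  For \<open>0 \<le> \<gamma> < 1\<close> the discounted series converges and is bounded uniformly in the policy, so
  the supremum is a proper one.
\<close>

definition Q_opt ::
  "('x::finite \<Rightarrow> 'u::finite \<Rightarrow> 'x pmf) \<Rightarrow> ('x \<Rightarrow> 'u \<Rightarrow> real ^ 'x) \<Rightarrow> real \<Rightarrow> 'x \<Rightarrow> 'u \<Rightarrow> real"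
where
  "Q_opt P R \<gamma> i j = (SUP \<pi>. Q_policy P R \<gamma> \<pi> i j)"

definition vmax :: "('x::finite \<Rightarrow> 'u::finite \<Rightarrow> real) \<Rightarrow> real ^ 'x"
  where "vmax Q = (\<chi> x. Max (range (Q x)))"

abbreviation v_opt ::
  "('x::finite \<Rightarrow> 'u::finite \<Rightarrow> 'x pmf) \<Rightarrow> ('x \<Rightarrow> 'u \<Rightarrow> real ^ 'x) \<Rightarrow> real \<Rightarrow> real ^ 'x"
  where "v_opt P R \<gamma> \<equiv> vmax (Q_opt P R \<gamma>)"

definition value_drift ::
  "('x::finite \<Rightarrow> 'u::finite \<Rightarrow> 'x pmf) \<Rightarrow> ('x \<Rightarrow> 'u \<Rightarrow> 'x pmf) \<Rightarrow> ('x \<Rightarrow> 'u \<Rightarrow> real ^ 'x) \<Rightarrow> real \<Rightarrow>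
    'x \<Rightarrow> 'u \<Rightarrow> real"
where
  "value_drift P Phat R \<gamma> i j =
     (prow (P i j) - prow (Phat i j)) \<bullet> (R i j + \<gamma> *\<^sub>R v_opt P R \<gamma>)"

definition min_value_drift ::
  "('x::finite \<Rightarrow> 'u::finite \<Rightarrow> 'x pmf) \<Rightarrow> ('x \<Rightarrow> 'u \<Rightarrow> 'x pmf) \<Rightarrow> ('x \<Rightarrow> 'u \<Rightarrow> real ^ 'x) \<Rightarrow> real \<Rightarrow> real"
where
  "min_value_drift P Phat R \<gamma> = Min (range (\<lambda>(i, j). \<bar>value_drift P Phat R \<gamma> i j\<bar>))"


section \<open>The detection phase\<close>

text \<open>
  Detection starts at time \<open>0\<close>, so a detection phase of length \<open>n\<close> consists of the times
  \<open>t < n\<close>.  At time \<open>t\<close> the agent sees the state \<open>st t\<close>, plays \<open>act t\<close>, is shown the next state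
  \<open>st (Suc t)\<close> and receives the reward for the transition shown plus \<open>noise t\<close>; \<open>atk t\<close> says
  whether the adversary attacks at time \<open>t\<close>.  The sigma-algebra \<open>hist t\<close> is the information
  available before the next state and the noise of time \<open>t\<close> are drawn; in particular
  \<open>hist 0\<close> contains the training phase and hence the learned estimate \<open>qhat\<close>.
\<close>

record ('w, 'x, 'u) phase =
  pspace :: "'w measure"
  hist :: "nat \<Rightarrow> 'w measure"
  st :: "nat \<Rightarrow> 'w \<Rightarrow> 'x"
  act :: "nat \<Rightarrow> 'w \<Rightarrow> 'u"
  atk :: "nat \<Rightarrow> 'w \<Rightarrow> bool"
  noise :: "nat \<Rightarrow> 'w \<Rightarrow> real"
  qhat :: "'w \<Rightarrow> 'x \<Rightarrow> 'u \<Rightarrow> real"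

definition history_ok :: "('w, 'x, 'u) phase \<Rightarrow> bool"
where
  "history_ok D \<longleftrightarrow>
     prob_space (pspace D) \<and>
     filtration (space (pspace D)) (hist D) \<and>
     (\<forall>t. subalgebra (pspace D) (hist D t)) \<and>
     (\<forall>t. st D t \<in> measurable (hist D t) (count_space UNIV)) \<and>
     (\<forall>t. act D t \<in> measurable (hist D t) (count_space UNIV)) \<and>
     (\<forall>t. atk D t \<in> measurable (hist D t) (count_space UNIV)) \<and>
     (\<forall>t. noise D t \<in> borel_measurable (hist D (Suc t))) \<and>
     (\<forall>x u. (\<lambda>\<omega>. qhat D \<omega> x u) \<in> borel_measurable (hist D 0))"

text \<open>The agent's policy and the adversary's switching rule are arbitrary functions of the past.\<close>

definition transitions_ok ::
  "('x::finite \<Rightarrow> 'u::finite \<Rightarrow> 'x pmf) \<Rightarrow> ('x \<Rightarrow> 'u \<Rightarrow> 'x pmf) \<Rightarrow> ('w, 'x, 'u) phase \<Rightarrow> bool"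
where
  "transitions_ok P Phat D \<longleftrightarrow>
     (\<forall>t x'. AE \<omega> in pspace D.
        real_cond_exp (pspace D) (hist D t)
          (indicat_real {\<omega> \<in> space (pspace D). st D (Suc t) \<omega> = x'}) \<omega> =
        pmf ((if atk D t \<omega> then Phat else P) (st D t \<omega>) (act D t \<omega>)) x')"

text \<open>
  Since \<open>noise t\<close> is \<open>hist (Suc t)\<close>-measurable, independence of the past makes the noise
  sequence mutually independent, hence i.i.d.
\<close>

definition noise_ok :: "('w, 'x, 'u) phase \<Rightarrow> bool"
where
  "noise_ok D \<longleftrightarrow>
     (\<forall>t. prob_space.indep_set (pspace D) (sets (hist D t))
            (sets (vimage_algebra (space (pspace D)) (noise D t) borel))) \<and>
     (\<forall>t. distr (pspace D) borel (noise D t) = distr (pspace D) borel (noise D 0)) \<and>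
     (\<forall>t. integrable (pspace D) (noise D t) \<and> (\<integral>\<omega>. noise D t \<omega> \<partial>pspace D) = 0)"

definition detection_phase ::
  "('x::finite \<Rightarrow> 'u::finite \<Rightarrow> 'x pmf) \<Rightarrow> ('x \<Rightarrow> 'u \<Rightarrow> 'x pmf) \<Rightarrow> ('w, 'x, 'u) phase \<Rightarrow> bool"
where
  "detection_phase P Phat D \<longleftrightarrow> history_ok D \<and> transitions_ok P Phat D \<and> noise_ok D"

definition visits :: "('w, 'x, 'u) phase \<Rightarrow> nat \<Rightarrow> 'x \<Rightarrow> 'u \<Rightarrow> 'w \<Rightarrow> nat set"
  where "visits D n i j \<omega> = {t. t < n \<and> st D t \<omega> = i \<and> act D t \<omega> = j}"

definition visited_forever :: "('w, 'x, 'u) phase \<Rightarrow> 'x \<Rightarrow> 'u \<Rightarrow> 'w \<Rightarrow> bool"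
  where "visited_forever D i j \<omega> \<longleftrightarrow> filterlim (\<lambda>n. card (visits D n i j \<omega>)) at_top sequentially"

definition secure :: "('w, 'x, 'u) phase \<Rightarrow> bool"
  where "secure D \<longleftrightarrow> (\<forall>t. \<forall>\<omega>\<in>space (pspace D). \<not> atk D t \<omega>)"

text \<open>
  The overall fraction of attacked time steps is \<open>\<nu>\<close>, and so is the fraction of attacked visits
  to every pair that is visited forever.  The second clause says that switching does not
  discriminate between pairs.  It does not follow from the first: on a trajectory alternating
  between two pairs, attacking every second step has overall fraction 1/2 but attacks one pair
  always and the other never.
\<close>

definition dynamic_attack :: "real \<Rightarrow> ('w, 'x, 'u) phase \<Rightarrow> bool"
where
  "dynamic_attack \<nu> D \<longleftrightarrow>
     (AE \<omega> in pspace D. (\<lambda>n. (\<Sum>t<n. of_bool (atk D t \<omega>)) / real n) \<longlonglongrightarrow> \<nu>) \<and>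
     (\<forall>i j. AE \<omega> in pspace D. visited_forever D i j \<omega> \<longrightarrow>
        (\<lambda>n. (\<Sum>t\<in>visits D n i j \<omega>. of_bool (atk D t \<omega>)) / real (card (visits D n i j \<omega>)))
          \<longlonglongrightarrow> \<nu>)"


section \<open>Bellman Deviation Detection\<close>

definition bellman_dev ::
  "('x::finite \<Rightarrow> 'u::finite \<Rightarrow> real ^ 'x) \<Rightarrow> real \<Rightarrow> ('w, 'x, 'u) phase \<Rightarrow> nat \<Rightarrow> 'w \<Rightarrow> real"
where
  "bellman_dev R \<gamma> D t \<omega> =
     (let i = st D t \<omega>; j = act D t \<omega>; x' = st D (Suc t) \<omega>
      in qhat D \<omega> i j - R i j $ x' - noise D t \<omega> - \<gamma> * vmax (qhat D \<omega>) $ x')"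

definition mean_dev ::
  "('x::finite \<Rightarrow> 'u::finite \<Rightarrow> real ^ 'x) \<Rightarrow> real \<Rightarrow> ('w, 'x, 'u) phase \<Rightarrow> nat \<Rightarrow> 'x \<Rightarrow> 'u \<Rightarrow> 'w \<Rightarrow> real"
where
  "mean_dev R \<gamma> D n i j \<omega> =
     (\<Sum>t\<in>visits D n i j \<omega>. bellman_dev R \<gamma> D t \<omega>) / real (card (visits D n i j \<omega>))"

definition retained :: "('w, 'x::finite, 'u::finite) phase \<Rightarrow> nat \<Rightarrow> 'w \<Rightarrow> ('x \<times> 'u) set"
where
  "retained D n \<omega> =
     {(i, j). real (card (visits D n i j \<omega>)) > real n / (2 * real CARD('x) * real CARD('u))}"

text \<open>\<open>retained D n \<omega>\<close> is nonempty for \<open>n > 0\<close>, so the maximum is a proper one.\<close>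

definition breach ::
  "('x::finite \<Rightarrow> 'u::finite \<Rightarrow> real ^ 'x) \<Rightarrow> real \<Rightarrow> real \<Rightarrow> ('w, 'x, 'u) phase \<Rightarrow> nat \<Rightarrow> 'w \<Rightarrow> bool"
where
  "breach R \<gamma> eb D n \<omega> \<longleftrightarrow>
     Max ((\<lambda>(i, j). \<bar>mean_dev R \<gamma> D n i j \<omega>\<bar>) ` retained D n \<omega>) > (1 + \<gamma>) * eb"

definition accurate ::
  "('x::finite \<Rightarrow> 'u::finite \<Rightarrow> 'x pmf) \<Rightarrow> ('x \<Rightarrow> 'u \<Rightarrow> real ^ 'x) \<Rightarrow> real \<Rightarrow> real \<Rightarrow>
    ('w, 'x, 'u) phase \<Rightarrow> 'w \<Rightarrow> bool"
where
  "accurate P R \<gamma> e D \<omega> \<longleftrightarrow> (\<forall>x u. \<bar>qhat D \<omega> x u - Q_opt P R \<gamma> x u\<bar> \<le> e)"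

definition prob_of :: "('w, 'x, 'u) phase \<Rightarrow> ('w \<Rightarrow> bool) \<Rightarrow> real"
  where "prob_of D E = measure (pspace D) {\<omega> \<in> space (pspace D). E \<omega>}"

definition whp :: "('w, 'x, 'u) phase \<Rightarrow> (nat \<Rightarrow> 'w \<Rightarrow> bool) \<Rightarrow> bool"
  where "whp D E \<longleftrightarrow> (\<lambda>n. prob_of D (E n)) \<longlonglongrightarrow> 1"

definition whp_limit ::
  "('w, 'x, 'u) phase \<Rightarrow> (nat \<Rightarrow> 'w \<Rightarrow> real) \<Rightarrow> ('w \<Rightarrow> real) \<Rightarrow> bool"
  where "whp_limit D Z L \<longleftrightarrow> (\<forall>\<delta>>0. whp D (\<lambda>n \<omega>. \<bar>Z n \<omega> - L \<omega>\<bar> < \<delta>))"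

end

theory Submission
  imports Defs
begin

text \<open>
  Fix a pair \<open>(i, j)\<close>.  Along its visits the centered transition indicators and the noise are
  martingale differences sampled at predictable times.  Dividing the term of the \<open>k\<close>-th visit by
  \<open>k\<close> (and truncating the noise there at level \<open>k\<close>, because it has only a first moment) gives
  martingales bounded in \<open>L\<^sup>2\<close>, which converge almost surely by Kolmogorov's maximal
  inequality; Kronecker's lemma then yields the strong law at random visit times.  Convergence in
  probability along a deterministic number of visits would not be enough, since the number of visits
  up to time \<open>n\<close> may depend on the past noise.  So the empirical law of the next states tends to
  \<open>(1 - \<nu>) p + \<nu> p'\<close>, where \<open>p\<close> and \<open>p'\<close> are the true and the adversary's transition
  row, and the Bellman equation turns the mean deviation into the asserted limit.  For an accurate
  estimate that limit is within \<open>(1 + \<gamma>) e\<close> of the multiple \<open>\<nu>\<close> of the value drift, which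
  separates the two cases.
\<close>

section \<open>Weighted means of real sequences\<close>

text \<open>In the long run the states shown under attack follow the mixture row, so
  \<open>v_opt P R \<gamma> - vmax (qhat D \<omega>)\<close> is averaged with the mixture, not with
  the true row alone. The two averages agree when \<nu> = 0; otherwise, for an estimate with error
  e, they shift the limit by at most 2 * \<gamma> * \<nu> * e. Hence the attack case carries two
  claims: an exact limit with the mixture, and the formula with the true row up to an error that
  vanishes with training. The limits are available only for pairs visited forever, while the test
  looks at retained pairs. Pigeonhole retains some pair at every positive horizon, and eventually
  every retained pair is visited forever. Which pairs these are depends on the trajectory, so
  detection needs a large drift at every pair: this is why the condition involves the minimum over
  pairs. When secure, a limit equal to the threshold would not decide on which side the means lie,
  so the error must be strictly below \<open>eb\<close>; since \<open>0 < eb\<close>, this holds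
  after enough training.\<close>

text \<open>Toeplitz averaging: the head, where \<open>c\<close> is not yet small, is finite and is
  swamped by the diverging total weight. Weights may vanish, as they do at times without a
  visit.\<close>

lemma weighted_mean_tendsto_zero:
  fixes v c :: "nat \<Rightarrow> real"
  assumes v: "\<And>t. 0 \<le> v t"
    and S: "filterlim (\<lambda>n. \<Sum>t<n. v t) at_top sequentially"
    and c: "c \<longlonglongrightarrow> 0"
  shows "(\<lambda>n. (\<Sum>t<n. v t * c t) / (\<Sum>t<n. v t)) \<longlonglongrightarrow> 0"
proof (rule LIMSEQ_I)
  fix e :: real assume e: "0 < e"
  obtain m where m: "\<And>t. m \<le> t \<Longrightarrow> \<bar>c t\<bar> < e / 2"
    using LIMSEQ_D[OF c, of "e / 2"] e by auto
  define A where "A = (\<Sum>t<m. v t * \<bar>c t\<bar>)"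
  have A: "0 \<le> A" unfolding A_def by (intro sum_nonneg) (simp add: v)
  have bound: "\<bar>\<Sum>t<n. v t * c t\<bar> \<le> A + e / 2 * (\<Sum>t<n. v t)" if n: "m \<le> n" for n
  proof -
    have "\<bar>\<Sum>t<n. v t * c t\<bar> \<le> (\<Sum>t<n. v t * \<bar>c t\<bar>)"
      by (rule order_trans[OF sum_abs]) (simp add: abs_mult v)
    also have "\<dots> = A + (\<Sum>t\<in>{m..<n}. v t * \<bar>c t\<bar>)"
      unfolding A_def lessThan_atLeast0 using n by (simp add: sum.atLeastLessThan_concat)
    also have "(\<Sum>t\<in>{m..<n}. v t * \<bar>c t\<bar>) \<le> (\<Sum>t\<in>{m..<n}. v t * (e / 2))"
      using m v by (intro sum_mono mult_left_mono) (auto intro: less_imp_le)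
    also have "\<dots> \<le> (\<Sum>t<n. v t * (e / 2))"
      using e v by (intro sum_mono2) auto
    also have "\<dots> = e / 2 * (\<Sum>t<n. v t)"
      by (simp only: sum_distrib_right[symmetric] mult.commute)
    finally show ?thesis by simp
  qed
  have "\<forall>\<^sub>F n in sequentially. 2 * A / e < (\<Sum>t<n. v t)"
    using S unfolding filterlim_at_top_dense by blast
  then obtain n0 where n0: "\<And>n. n0 \<le> n \<Longrightarrow> 2 * A / e < (\<Sum>t<n. v t)"
    unfolding eventually_sequentially by blast
  have "norm ((\<Sum>t<n. v t * c t) / (\<Sum>t<n. v t) - 0) < e" if n: "max m n0 \<le> n" for n
  proof -
    have s: "2 * A / e < (\<Sum>t<n. v t)" using n0 n by auto
    moreover have "0 \<le> 2 * A / e" using A e by simp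
    ultimately have pos: "0 < (\<Sum>t<n. v t)" by linarith
    have "2 * A < e * (\<Sum>t<n. v t)" using s e by (simp add: field_simps)
    then have "\<bar>\<Sum>t<n. v t * c t\<bar> < e * (\<Sum>t<n. v t)"
      using bound[of n] n by auto
    then show ?thesis using pos by (simp add: field_simps)
  qed
  then show "\<exists>no. \<forall>n\<ge>no. norm ((\<Sum>t<n. v t * c t) / (\<Sum>t<n. v t) - 0) < e" by blast
qed

text \<open>With visit indicators as weights, the coefficient of \<open>d t\<close> is the number of
  visits up to and including time \<open>t\<close>.\<close>

lemma kronecker_lemma:
  fixes v d :: "nat \<Rightarrow> real"
  assumes v: "\<And>t. 0 \<le> v t"
    and S: "filterlim (\<lambda>n. \<Sum>t<n. v t) at_top sequentially"
    and d: "convergent (\<lambda>n. \<Sum>t<n. d t)"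
  shows "(\<lambda>n. (\<Sum>t<n. (\<Sum>s<Suc t. v s) * d t) / (\<Sum>t<n. v t)) \<longlonglongrightarrow> 0"
proof -
  define D where "D n = (\<Sum>t<n. d t)" for n
  obtain L where L: "D \<longlonglongrightarrow> L" using d unfolding convergent_def D_def by blast
  \<comment> \<open>Abel summation. Measuring \<open>D\<close> from its limit \<open>L\<close> costs
    nothing, since the two contributions of \<open>L\<close> cancel, and it makes both terms
    negligible after division.\<close>
  have parts: "(\<Sum>t<n. (\<Sum>s<Suc t. v s) * d t)
      = (\<Sum>t<n. v t) * (D n - L) - (\<Sum>t<n. v t * (D t - L))" for n
    by (induction n) (simp_all add: D_def algebra_simps)
  have "(\<lambda>n. (\<Sum>t<n. v t * (D t - L)) / (\<Sum>t<n. v t)) \<longlonglongrightarrow> 0"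
    using L by (intro weighted_mean_tendsto_zero v S) (simp add: LIM_zero_iff)
  moreover have "(\<lambda>n. D n - L) \<longlonglongrightarrow> 0" using L by (simp add: LIM_zero_iff)
  ultimately have "(\<lambda>n. (D n - L) - (\<Sum>t<n. v t * (D t - L)) / (\<Sum>t<n. v t)) \<longlonglongrightarrow> 0 - 0"
    by (intro tendsto_diff)
  moreover have "\<forall>\<^sub>F n in sequentially. 0 < (\<Sum>t<n. v t)"
    using S unfolding filterlim_at_top_dense by blast
  then have "\<forall>\<^sub>F n in sequentially. (D n - L) - (\<Sum>t<n. v t * (D t - L)) / (\<Sum>t<n. v t)
      = (\<Sum>t<n. (\<Sum>s<Suc t. v s) * d t) / (\<Sum>t<n. v t)"
    by eventually_elim (simp only: parts, simp add: diff_divide_distrib)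
  ultimately show ?thesis by (simp add: filterlim_cong)
qed

section \<open>Counting visits and averaging over them\<close>

definition count_before :: "(nat \<Rightarrow> bool) \<Rightarrow> nat \<Rightarrow> nat"
  where "count_before V n = card {t. t < n \<and> V t}"

lemma count_before_eq_sum: "count_before V n = (\<Sum>t<n. of_bool (V t))"
proof -
  have "{t. t < n \<and> V t} = {..<n} \<inter> {t. V t}" by auto
  then show ?thesis by (simp add: count_before_def sum.If_cases of_bool_def)
qed

lemma count_before_Suc: "count_before V (Suc n) = count_before V n + of_bool (V n)"
  by (simp add: count_before_eq_sum)

lemma count_before_0 [simp]: "count_before V 0 = 0"
  by (simp add: count_before_def)

lemma count_before_le: "count_before V n \<le> n"
  by (induction n) (auto simp: count_before_Suc)

lemma count_before_mono: "m \<le> n \<Longrightarrow> count_before V m \<le> count_before V n"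
  unfolding count_before_def by (intro card_mono) auto

lemma real_count_before: "real (count_before V n) = (\<Sum>t<n. of_bool (V t))"
  by (simp add: count_before_eq_sum of_nat_of_bool)

text \<open>At a visit, \<open>count_before V (Suc t)\<close> is the ordinal of that visit, so the
  visits run through 1, 2, 3, ... once each. Random visit times thereby disappear from the bound of
  a sum.\<close>

lemma sum_visits_reindex:
  fixes f :: "nat \<Rightarrow> real"
  shows "(\<Sum>t<n. of_bool (V t) * f (count_before V (Suc t))) = (\<Sum>k=1..count_before V n. f k)"
  by (induction n) (auto simp: count_before_Suc)

lemma filterlim_count_before_real:
  "filterlim (\<lambda>n. \<Sum>t<n. of_bool (V t) :: real) at_top sequentially \<longleftrightarrow>
    filterlim (count_before V) at_top sequentially"
  unfolding real_count_before[symmetric]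
  by (auto intro: filterlim_compose[OF filterlim_real_sequentially]
      simp: filterlim_sequentially_iff_filterlim_real)

lemma visit_mean_tendsto_zero:
  assumes "filterlim (count_before V) at_top sequentially" "c \<longlonglongrightarrow> 0"
  shows "(\<lambda>n. (\<Sum>t<n. of_bool (V t) * c t) / real (count_before V n)) \<longlonglongrightarrow> 0"
  using assms unfolding real_count_before
  by (intro weighted_mean_tendsto_zero) (simp_all only: filterlim_count_before_real, simp)

lemma visit_mean_kronecker:
  assumes N: "filterlim (count_before V) at_top sequentially"
    and "convergent (\<lambda>n. \<Sum>t<n. of_bool (V t) * x t / real (count_before V (Suc t)))"
  shows "(\<lambda>n. (\<Sum>t<n. of_bool (V t) * x t) / real (count_before V n)) \<longlonglongrightarrow> 0"
proof -
  have "(\<lambda>n. (\<Sum>t<n. (\<Sum>s<Suc t. of_bool (V s)) * (of_bool (V t) * x t / real (count_before V (Suc t))))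
      / (\<Sum>t<n. of_bool (V t))) \<longlonglongrightarrow> 0"
    using assms by (intro kronecker_lemma) (simp_all only: filterlim_count_before_real, simp)
  then have "(\<lambda>n. (\<Sum>t<n. real (count_before V (Suc t)) * (of_bool (V t) * x t / real (count_before V (Suc t))))
      / real (count_before V n)) \<longlonglongrightarrow> 0"
    unfolding real_count_before .
  \<comment> \<open>At a visit the count is at least 1 and cancels; at any other time both sides are
    0, whatever the quotient.\<close>
  moreover have "real (count_before V (Suc t)) * (of_bool (V t) * x t / real (count_before V (Suc t)))
      = of_bool (V t) * x t" for t
    by (auto simp: count_before_Suc)
  ultimately show ?thesis by simp
qed

lemma sum_inverse_squares_tail_le:
  assumes "0 < m"
  shows "(\<Sum>k=m..n. 1 / (real k)\<^sup>2) \<le> 2 / real m"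
proof (cases "m \<le> n")
  case True
  \<comment> \<open>The extra \<open>- 1 / real n\<close> is what the induction needs: the next term
    is at most the telescoping difference 1/n - 1/(n+1).\<close>
  have "(\<Sum>k=m..n. 1 / (real k)\<^sup>2) \<le> 2 / real m - 1 / real n"
    using True
  proof (induction n rule: dec_induct)
    case base
    show ?case using assms by (simp add: field_simps power2_eq_square)
  next
    case (step n)
    have n: "0 < n" using step assms by simp
    have "1 / (real (Suc n))\<^sup>2 \<le> 1 / real n - 1 / real (Suc n)"
    proof -
      have "1 / real n - 1 / real (Suc n) = 1 / (real n * real (Suc n))"
        using n by (simp add: field_simps)
      moreover have "1 / (real (Suc n))\<^sup>2 \<le> 1 / (real n * real (Suc n))"
        using n by (intro divide_left_mono) (auto simp: power2_eq_square)
      ultimately show ?thesis by simp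
    qed
    then show ?case using step by simp
  qed
  also have "\<dots> \<le> 2 / real m" by simp
  finally show ?thesis .
qed simp

section \<open>Convergence of square-summable martingale differences\<close>

locale filtered_prob_space = prob_space M for M :: "'w measure" +
  fixes F :: "nat \<Rightarrow> 'w measure"
  assumes filtration_F: "filtration (space M) F"
    and subalgebra_F: "\<And>t. subalgebra M (F t)"
begin

lemma measurable_F_mono:
  assumes "f \<in> measurable (F s) N" "s \<le> t"
  shows "f \<in> measurable (F t) N"
proof (rule measurable_from_subalg[OF _ assms(1)])
  interpret filtration "space M" F by (rule filtration_F)
  show "subalgebra (F t) (F s)"
    using space_F sets_F_mono[OF assms(2)] by (simp add: subalgebra_def)
qed

lemma measurable_F_M: "f \<in> measurable (F t) N \<Longrightarrow> f \<in> measurable M N"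
  by (rule measurable_from_subalg[OF subalgebra_F])

lemma space_F_eq [simp]: "space (F t) = space M"
  using subalgebra_F[of t] by (simp add: subalgebra_def)

definition bounded_on_space :: "('w \<Rightarrow> real) \<Rightarrow> bool"
  where "bounded_on_space f \<longleftrightarrow> (\<exists>C. \<forall>\<omega>\<in>space M. \<bar>f \<omega>\<bar> \<le> C)"

lemma bounded_on_spaceI: "(\<And>\<omega>. \<omega> \<in> space M \<Longrightarrow> \<bar>f \<omega>\<bar> \<le> C) \<Longrightarrow> bounded_on_space f"
  by (auto simp: bounded_on_space_def)

lemma bounded_on_space_const [simp]: "bounded_on_space (\<lambda>_. c)"
  by (rule bounded_on_spaceI[where C = "\<bar>c\<bar>"]) simp

lemma bounded_on_space_add:
  assumes "bounded_on_space f" "bounded_on_space g"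
  shows "bounded_on_space (\<lambda>\<omega>. f \<omega> + g \<omega>)"
proof -
  obtain C1 C2 where C: "\<forall>\<omega>\<in>space M. \<bar>f \<omega>\<bar> \<le> C1" "\<forall>\<omega>\<in>space M. \<bar>g \<omega>\<bar> \<le> C2"
    using assms by (auto simp: bounded_on_space_def)
  show ?thesis
  proof (rule bounded_on_spaceI)
    fix \<omega> assume "\<omega> \<in> space M"
    then have "\<bar>f \<omega>\<bar> \<le> C1" "\<bar>g \<omega>\<bar> \<le> C2" using C by auto
    then show "\<bar>f \<omega> + g \<omega>\<bar> \<le> C1 + C2" by linarith
  qed
qed

lemma bounded_on_space_mult:
  assumes "bounded_on_space f" "bounded_on_space g"
  shows "bounded_on_space (\<lambda>\<omega>. f \<omega> * g \<omega>)"
proof -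
  obtain C1 C2 where C: "\<forall>\<omega>\<in>space M. \<bar>f \<omega>\<bar> \<le> C1" "\<forall>\<omega>\<in>space M. \<bar>g \<omega>\<bar> \<le> C2"
    using assms by (auto simp: bounded_on_space_def)
  show ?thesis
  proof (rule bounded_on_spaceI)
    fix \<omega> assume "\<omega> \<in> space M"
    then have "\<bar>f \<omega>\<bar> \<le> C1" "\<bar>g \<omega>\<bar> \<le> C2" using C by auto
    then show "\<bar>f \<omega> * g \<omega>\<bar> \<le> C1 * C2" unfolding abs_mult by (intro mult_mono) auto
  qed
qed

lemma bounded_on_space_sum:
  "(\<And>i. i \<in> I \<Longrightarrow> bounded_on_space (f i)) \<Longrightarrow> bounded_on_space (\<lambda>\<omega>. \<Sum>i\<in>I. f i \<omega>)"
  by (induction I rule: infinite_finite_induct) (auto intro: bounded_on_space_add)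

lemma integrable_bounded_on_space:
  assumes "f \<in> borel_measurable M" "bounded_on_space f"
  shows "integrable M f"
proof -
  obtain C where "\<forall>\<omega>\<in>space M. \<bar>f \<omega>\<bar> \<le> C"
    using assms(2) by (auto simp: bounded_on_space_def)
  then show ?thesis
    using assms(1) by (intro integrable_const_bound[where B = C]) auto
qed

text \<open>The martingale property is tested against bounded functions of the past instead of being
  stated with conditional expectations. As each increment is bounded too, every product below is
  integrable. The bound may depend on \<open>t\<close>, as it does for noise truncated at a growing
  level.\<close>

definition mart_diff :: "(nat \<Rightarrow> 'w \<Rightarrow> real) \<Rightarrow> bool"
  where "mart_diff D \<longleftrightarrow>
    (\<forall>t. D t \<in> borel_measurable (F (Suc t)) \<and> bounded_on_space (D t) \<and>
      (\<forall>g\<in>borel_measurable (F t). bounded_on_space g \<longrightarrow> (\<integral>\<omega>. g \<omega> * D t \<omega> \<partial>M) = 0))"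

lemma mart_diffD:
  assumes "mart_diff D"
  shows "D t \<in> borel_measurable (F (Suc t))" "D t \<in> borel_measurable M" "bounded_on_space (D t)"
    "g \<in> borel_measurable (F t) \<Longrightarrow> bounded_on_space g \<Longrightarrow> (\<integral>\<omega>. g \<omega> * D t \<omega> \<partial>M) = 0"
proof -
  show "D t \<in> borel_measurable (F (Suc t))" using assms by (simp add: mart_diff_def)
  then show "D t \<in> borel_measurable M" by (rule measurable_F_M)
qed (use assms in \<open>auto simp: mart_diff_def\<close>)

text \<open>The predictable factor is absorbed into the test function. Stopping, starting at a later
  time and dividing by the visit number are all instances of this transform.\<close>

lemma mart_diff_predictable_mult:
  assumes D: "mart_diff D"
    and g: "\<And>t. g t \<in> borel_measurable (F t)" "\<And>t. bounded_on_space (g t)"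
  shows "mart_diff (\<lambda>t \<omega>. g t \<omega> * D t \<omega>)"
  unfolding mart_diff_def
proof (intro allI conjI ballI impI)
  fix t
  have "g t \<in> borel_measurable (F (Suc t))" using g(1) by (rule measurable_F_mono) simp
  then show "(\<lambda>\<omega>. g t \<omega> * D t \<omega>) \<in> borel_measurable (F (Suc t))"
    using mart_diffD(1)[OF D] by (rule borel_measurable_times)
  show "bounded_on_space (\<lambda>\<omega>. g t \<omega> * D t \<omega>)"
    by (rule bounded_on_space_mult[OF g(2) mart_diffD(3)[OF D]])
  fix f assume f: "f \<in> borel_measurable (F t)" "bounded_on_space f"
  have "(\<integral>\<omega>. (f \<omega> * g t \<omega>) * D t \<omega> \<partial>M) = 0"
    by (intro mart_diffD(4)[OF D] borel_measurable_times f g bounded_on_space_mult)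
  then show "(\<integral>\<omega>. f \<omega> * (g t \<omega> * D t \<omega>) \<partial>M) = 0" by (simp add: mult.assoc)
qed

lemma mart_diff_sum_measurable:
  assumes "mart_diff D"
  shows "(\<lambda>\<omega>. \<Sum>t<n. D t \<omega>) \<in> borel_measurable (F n)"
  by (intro borel_measurable_sum measurable_F_mono[OF mart_diffD(1)[OF assms]]) auto

lemma mart_diff_sum_bounded: "mart_diff D \<Longrightarrow> bounded_on_space (\<lambda>\<omega>. \<Sum>t<n. D t \<omega>)"
  by (intro bounded_on_space_sum mart_diffD(3))

lemma mart_diff_square_integrable:
  assumes "mart_diff D"
  shows "integrable M (\<lambda>\<omega>. (D t \<omega>)\<^sup>2)"
proof (rule integrable_bounded_on_space)
  show "(\<lambda>\<omega>. (D t \<omega>)\<^sup>2) \<in> borel_measurable M"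
    by (intro borel_measurable_power mart_diffD(2)[OF assms])
  show "bounded_on_space (\<lambda>\<omega>. (D t \<omega>)\<^sup>2)"
    unfolding power2_eq_square by (intro bounded_on_space_mult mart_diffD(3)[OF assms])
qed

lemma mart_diff_sum_square_integrable:
  assumes "mart_diff D"
  shows "integrable M (\<lambda>\<omega>. (\<Sum>t<n. D t \<omega>)\<^sup>2)"
proof (rule integrable_bounded_on_space)
  show "(\<lambda>\<omega>. (\<Sum>t<n. D t \<omega>)\<^sup>2) \<in> borel_measurable M"
    by (intro borel_measurable_power borel_measurable_sum mart_diffD(2)[OF assms])
  show "bounded_on_space (\<lambda>\<omega>. (\<Sum>t<n. D t \<omega>)\<^sup>2)"
    unfolding power2_eq_square by (intro bounded_on_space_mult mart_diff_sum_bounded[OF assms])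
qed

text \<open>The partial sum before time \<open>n\<close> is itself a bounded function of the past,
  hence an admissible test function, and the cross term vanishes.\<close>

lemma mart_diff_orthogonal:
  assumes D: "mart_diff D"
  shows "(\<integral>\<omega>. (\<Sum>t<n. D t \<omega>)\<^sup>2 \<partial>M) = (\<Sum>t<n. \<integral>\<omega>. (D t \<omega>)\<^sup>2 \<partial>M)"
proof (induction n)
  case (Suc n)
  let ?S = "\<lambda>\<omega>. \<Sum>t<n. D t \<omega>"
  have cross: "(\<integral>\<omega>. ?S \<omega> * D n \<omega> \<partial>M) = 0"
    by (intro mart_diffD(4)[OF D] mart_diff_sum_measurable mart_diff_sum_bounded D)
  have icross: "integrable M (\<lambda>\<omega>. ?S \<omega> * D n \<omega>)"
    by (intro integrable_bounded_on_space bounded_on_space_mult mart_diff_sum_bounded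
        borel_measurable_times borel_measurable_sum mart_diffD(2,3) D)
  have "(\<integral>\<omega>. (\<Sum>t<Suc n. D t \<omega>)\<^sup>2 \<partial>M)
      = (\<integral>\<omega>. (?S \<omega>)\<^sup>2 + (2 * (?S \<omega> * D n \<omega>) + (D n \<omega>)\<^sup>2) \<partial>M)"
    by (simp add: power2_sum algebra_simps)
  also have "\<dots> = (\<integral>\<omega>. (?S \<omega>)\<^sup>2 \<partial>M) + (2 * (\<integral>\<omega>. ?S \<omega> * D n \<omega> \<partial>M) + (\<integral>\<omega>. (D n \<omega>)\<^sup>2 \<partial>M))"
    using icross mart_diff_square_integrable[OF D] mart_diff_sum_square_integrable[OF D] by simp
  finally show ?case using Suc cross by simp
qed simp

text \<open>
  The increments are switched off once the partial sums have left \<open>(- e, e)\<close>; then the final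
  partial sum remembers an earlier exit, and Chebyshev's inequality applies to it.
\<close>

lemma mart_diff_maximal_inequality:
  assumes D: "mart_diff D" and e: "0 < e"
  shows "prob {\<omega>\<in>space M. \<exists>k\<le>n. e \<le> \<bar>\<Sum>t<k. D t \<omega>\<bar>} \<le> (\<Sum>t<n. \<integral>\<omega>. (D t \<omega>)\<^sup>2 \<partial>M) / e\<^sup>2"
proof -
  \<comment> \<open>The partial sums up to index \<open>t\<close> involve only increments before
    time \<open>t\<close>, so the switch for the increment at \<open>t\<close> is known at
    \<open>t\<close>; including the sum with index \<open>t + 1\<close> would destroy
    predictability.\<close>
  define g where "g t \<omega> = (if \<forall>k\<in>{..t}. \<bar>\<Sum>s<k. D s \<omega>\<bar> < e then 1 else 0 :: real)" for t \<omega>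
  have gm: "g t \<in> borel_measurable (F t)" for t
  proof -
    have "Measurable.pred (F t) (\<lambda>\<omega>. \<bar>\<Sum>s<k. D s \<omega>\<bar> < e)" if "k \<in> {..t}" for k
    proof -
      have [measurable]: "(\<lambda>\<omega>. \<Sum>s<k. D s \<omega>) \<in> borel_measurable (F t)"
        using mart_diff_sum_measurable[OF D] by (rule measurable_F_mono) (use that in simp)
      show ?thesis by measurable
    qed
    then have "Measurable.pred (F t) (\<lambda>\<omega>. \<forall>k\<in>{..t}. \<bar>\<Sum>s<k. D s \<omega>\<bar> < e)"
      by (rule pred_intros_finite(3)[OF finite_atMost])
    from predE[OF this] show ?thesis unfolding g_def by (intro measurable_If borel_measurable_const)
  qed
  have gb: "bounded_on_space (g t)" for t
    by (rule bounded_on_spaceI[where C = 1]) (simp add: g_def)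
  define D' where "D' t \<omega> = g t \<omega> * D t \<omega>" for t \<omega>
  have D': "mart_diff D'"
    unfolding D'_def by (intro mart_diff_predictable_mult D gm gb)
  \<comment> \<open>After an exit the switched sum is frozen at its value at the first exit, which
    is at least \<open>e\<close> in absolute value. The \<open>LEAST\<close> is used only once an
    exit has occurred.\<close>
  have stopped: "(\<Sum>t<m. D' t \<omega>) = (if \<exists>k\<le>m. e \<le> \<bar>\<Sum>t<k. D t \<omega>\<bar>
      then \<Sum>t<(LEAST k. e \<le> \<bar>\<Sum>t<k. D t \<omega>\<bar>). D t \<omega> else \<Sum>t<m. D t \<omega>)" for m \<omega>
  proof (induction m)
    case 0
    then show ?case using e by simp
  next
    case (Suc m)
    show ?case
    proof (cases "\<exists>k\<le>m. e \<le> \<bar>\<Sum>t<k. D t \<omega>\<bar>")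
      case True
      then have "g m \<omega> = 0" by (auto simp: g_def not_less)
      moreover have "\<exists>k\<le>Suc m. e \<le> \<bar>\<Sum>t<k. D t \<omega>\<bar>" using True le_SucI by blast
      ultimately show ?thesis using Suc True by (simp add: D'_def)
    next
      case False
      then have "\<forall>k\<in>{..m}. \<bar>\<Sum>t<k. D t \<omega>\<bar> < e" by (meson atMost_iff not_less)
      then have "g m \<omega> = 1" unfolding g_def by (rule if_P)
      moreover have "(\<Sum>t<m. D' t \<omega>) = (\<Sum>t<m. D t \<omega>)" using Suc by (simp only: False if_False)
      ultimately have eq: "(\<Sum>t<Suc m. D' t \<omega>) = (\<Sum>t<Suc m. D t \<omega>)" by (simp add: D'_def)
      show ?thesis
      proof (cases "e \<le> \<bar>\<Sum>t<Suc m. D t \<omega>\<bar>")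
        case True
        then have "(LEAST k. e \<le> \<bar>\<Sum>t<k. D t \<omega>\<bar>) = Suc m"
          using False by (intro Least_equality) (assumption, meson not_less_eq_eq)
        then show ?thesis using True eq by auto
      next
        case False2: False
        then have "\<not> (\<exists>k\<le>Suc m. e \<le> \<bar>\<Sum>t<k. D t \<omega>\<bar>)" using False by (auto simp: le_Suc_eq)
        then show ?thesis using eq by (simp only: if_False)
      qed
    qed
  qed
  have sub: "{\<omega>\<in>space M. \<exists>k\<le>n. e \<le> \<bar>\<Sum>t<k. D t \<omega>\<bar>} \<subseteq> {\<omega>\<in>space M. e \<le> \<bar>\<Sum>t<n. D' t \<omega>\<bar>}"
  proof (intro subsetI, clarify)
    fix \<omega> k assume "\<omega> \<in> space M" and k: "k \<le> n" "e \<le> \<bar>\<Sum>t<k. D t \<omega>\<bar>"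
    from k(2) have "e \<le> \<bar>\<Sum>t<(LEAST k. e \<le> \<bar>\<Sum>t<k. D t \<omega>\<bar>). D t \<omega>\<bar>"
      by (rule LeastI)
    then show "e \<le> \<bar>\<Sum>t<n. D' t \<omega>\<bar>" using k by (subst stopped) auto
  qed
  have mD': "(\<lambda>\<omega>. \<Sum>t<n. D' t \<omega>) \<in> borel_measurable M"
    by (intro borel_measurable_sum mart_diffD(2)[OF D'])
  have ev: "{\<omega>\<in>space M. e \<le> \<bar>\<Sum>t<n. D' t \<omega>\<bar>} \<in> sets M"
    using mD' by measurable
  have "prob {\<omega>\<in>space M. \<exists>k\<le>n. e \<le> \<bar>\<Sum>t<k. D t \<omega>\<bar>}
      \<le> prob {\<omega>\<in>space M. e \<le> \<bar>\<Sum>t<n. D' t \<omega>\<bar>}"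
    by (rule finite_measure_mono[OF sub ev])
  also have "\<dots> \<le> (\<integral>\<omega>. (\<Sum>t<n. D' t \<omega>)\<^sup>2 \<partial>M) / e\<^sup>2"
    using mart_diff_sum_square_integrable[OF D'] mD' e by (intro second_moment_method)
  also have "\<dots> \<le> (\<Sum>t<n. \<integral>\<omega>. (D t \<omega>)\<^sup>2 \<partial>M) / e\<^sup>2"
    unfolding mart_diff_orthogonal[OF D'] using e
  proof (intro divide_right_mono sum_mono integral_mono mart_diff_square_integrable D D')
    show "(D' t \<omega>)\<^sup>2 \<le> (D t \<omega>)\<^sup>2" for t \<omega> by (simp add: D'_def g_def)
  qed simp
  finally show ?thesis .
qed

text \<open>The finite inequality is applied to the increments from time \<open>m\<close> on. Its
  bound does not depend on the horizon, and the exit events increase with the horizon, so it passes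
  to their union.\<close>

lemma mart_diff_maximal_inequality_tail:
  assumes D: "mart_diff D" and e: "0 < e"
    and sm: "summable (\<lambda>t. \<integral>\<omega>. (D t \<omega>)\<^sup>2 \<partial>M)"
  shows "prob {\<omega>\<in>space M. \<exists>k\<ge>m. e \<le> \<bar>(\<Sum>t<k. D t \<omega>) - (\<Sum>t<m. D t \<omega>)\<bar>}
    \<le> (\<Sum>t. \<integral>\<omega>. (D (t + m) \<omega>)\<^sup>2 \<partial>M) / e\<^sup>2"
proof -
  define D' where "D' t \<omega> = (if m \<le> t then 1 else 0) * D t \<omega>" for t \<omega>
  have D': "mart_diff D'"
    unfolding D'_def by (intro mart_diff_predictable_mult D) auto
  have D'_sum: "(\<Sum>t<k. D' t \<omega>) = (if m \<le> k then (\<Sum>t<k. D t \<omega>) - (\<Sum>t<m. D t \<omega>) else 0)" for k \<omega>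
    by (induction k) (auto simp: D'_def not_le le_Suc_eq)
  have sq: "(\<integral>\<omega>. (D' t \<omega>)\<^sup>2 \<partial>M) = (if m \<le> t then \<integral>\<omega>. (D t \<omega>)\<^sup>2 \<partial>M else 0)" for t
    by (simp add: D'_def)
  have tail: "(\<Sum>t<n. \<integral>\<omega>. (D' t \<omega>)\<^sup>2 \<partial>M) \<le> (\<Sum>t. \<integral>\<omega>. (D (t + m) \<omega>)\<^sup>2 \<partial>M)" for n
  proof -
    have "(\<Sum>t<n. \<integral>\<omega>. (D' t \<omega>)\<^sup>2 \<partial>M) \<le> (\<Sum>t<n + m. \<integral>\<omega>. (D' t \<omega>)\<^sup>2 \<partial>M)"
      by (intro sum_mono2) auto
    also have "\<dots> = (\<Sum>t<n. \<integral>\<omega>. (D (t + m) \<omega>)\<^sup>2 \<partial>M)"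
      by (induction n) (simp_all add: sq)
    also have "\<dots> \<le> (\<Sum>t. \<integral>\<omega>. (D (t + m) \<omega>)\<^sup>2 \<partial>M)"
      using sm by (intro sum_le_suminf) (simp_all add: summable_iff_shift[of "\<lambda>t. \<integral>\<omega>. (D t \<omega>)\<^sup>2 \<partial>M"])
    finally show ?thesis .
  qed
  let ?A = "\<lambda>n. {\<omega>\<in>space M. \<exists>k\<le>n. e \<le> \<bar>\<Sum>t<k. D' t \<omega>\<bar>}"
  have meas [measurable]: "(\<lambda>\<omega>. \<Sum>t<k. D' t \<omega>) \<in> borel_measurable M" for k
    by (intro borel_measurable_sum mart_diffD(2)[OF D'])
  have "(\<lambda>n. prob (?A n)) \<longlonglongrightarrow> prob (\<Union>n. ?A n)"
  proof (rule finite_Lim_measure_incseq)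
    show "range ?A \<subseteq> sets M" by auto
    show "incseq ?A" unfolding incseq_def by (blast intro: order_trans)
  qed
  moreover have "prob (?A n) \<le> (\<Sum>t. \<integral>\<omega>. (D (t + m) \<omega>)\<^sup>2 \<partial>M) / e\<^sup>2" for n
    by (rule order_trans[OF mart_diff_maximal_inequality[OF D' e]])
      (intro divide_right_mono tail, simp)
  ultimately have "prob (\<Union>n. ?A n) \<le> (\<Sum>t. \<integral>\<omega>. (D (t + m) \<omega>)\<^sup>2 \<partial>M) / e\<^sup>2"
    by (intro LIMSEQ_le_const2) auto
  moreover have "(\<Union>n. ?A n) = {\<omega>\<in>space M. \<exists>k\<ge>m. e \<le> \<bar>(\<Sum>t<k. D t \<omega>) - (\<Sum>t<m. D t \<omega>)\<bar>}"
    using e by (auto simp: D'_sum split: if_splits)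
  ultimately show ?thesis by simp
qed

text \<open>A path that is not Cauchy at some tolerance leaves the band around its value at
  \<open>m\<close> for every \<open>m\<close>. The probability of leaving is at most a tail of a
  convergent series over the squared tolerance, so it tends to 0.\<close>

theorem mart_diff_convergent_AE:
  assumes D: "mart_diff D"
    and sm: "summable (\<lambda>t. \<integral>\<omega>. (D t \<omega>)\<^sup>2 \<partial>M)"
  shows "AE \<omega> in M. convergent (\<lambda>n. \<Sum>t<n. D t \<omega>)"
proof -
  have [measurable]: "D t \<in> borel_measurable M" for t by (rule mart_diffD(2)[OF D])
  have cauchy: "AE \<omega> in M. \<exists>m. \<forall>k\<ge>m. \<bar>(\<Sum>t<k. D t \<omega>) - (\<Sum>t<m. D t \<omega>)\<bar> < e" if e: "0 < e" for e
  proof -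
    let ?B = "\<lambda>m. {\<omega>\<in>space M. \<exists>k\<ge>m. e \<le> \<bar>(\<Sum>t<k. D t \<omega>) - (\<Sum>t<m. D t \<omega>)\<bar>}"
    have B: "?B m \<in> sets M" for m by measurable
    have "prob (\<Inter>m. ?B m) \<le> (\<Sum>t. \<integral>\<omega>. (D (t + m) \<omega>)\<^sup>2 \<partial>M) / e\<^sup>2" for m
    proof -
      have "prob (\<Inter>m. ?B m) \<le> prob (?B m)"
        using B by (intro finite_measure_mono) blast+
      also have "\<dots> \<le> (\<Sum>t. \<integral>\<omega>. (D (t + m) \<omega>)\<^sup>2 \<partial>M) / e\<^sup>2"
        by (rule mart_diff_maximal_inequality_tail[OF D e sm])
      finally show ?thesis .
    qed
    moreover have "(\<lambda>m. (\<Sum>t. \<integral>\<omega>. (D (t + m) \<omega>)\<^sup>2 \<partial>M) / e\<^sup>2) \<longlonglongrightarrow> 0 / e\<^sup>2"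
      using e by (intro tendsto_divide tendsto_const suminf_exist_split2[OF sm]) simp
    ultimately have "prob (\<Inter>m. ?B m) \<le> 0"
      by (intro LIMSEQ_le_const) auto
    then have "prob (\<Inter>m. ?B m) = 0" using measure_nonneg[of M "\<Inter>m. ?B m"] by linarith
    moreover have "(\<Inter>m. ?B m) \<in> sets M" using B by blast
    ultimately have "AE \<omega> in M. \<omega> \<notin> (\<Inter>m. ?B m)"
      by (subst (asm) prob_eq_0) auto
    moreover have "(\<exists>m. \<forall>k\<ge>m. \<bar>(\<Sum>t<k. D t \<omega>) - (\<Sum>t<m. D t \<omega>)\<bar> < e) \<longleftrightarrow> \<omega> \<notin> (\<Inter>m. ?B m)"
      if "\<omega> \<in> space M" for \<omega>
    proof -
      have "\<omega> \<in> ?B m \<longleftrightarrow> \<not> (\<forall>k\<ge>m. \<bar>(\<Sum>t<k. D t \<omega>) - (\<Sum>t<m. D t \<omega>)\<bar> < e)" for m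
        using that by (simp only: mem_Collect_eq not_all not_imp not_less simp_thms)
      then show ?thesis by blast
    qed
    ultimately show ?thesis by (simp cong: AE_cong_simp)
  qed
  \<comment> \<open>Only countably many tolerances may share one exceptional null set, hence the
    reciprocals of integers.\<close>
  have "AE \<omega> in M. \<forall>j. \<exists>m. \<forall>k\<ge>m. \<bar>(\<Sum>t<k. D t \<omega>) - (\<Sum>t<m. D t \<omega>)\<bar> < 1 / real (Suc j)"
    unfolding AE_all_countable by (intro allI cauchy) simp
  then show ?thesis
  proof (rule AE_mp, intro AE_I2 impI)
    fix \<omega>
    assume *: "\<forall>j. \<exists>m. \<forall>k\<ge>m. \<bar>(\<Sum>t<k. D t \<omega>) - (\<Sum>t<m. D t \<omega>)\<bar> < 1 / real (Suc j)"
    show "convergent (\<lambda>n. \<Sum>t<n. D t \<omega>)"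
      unfolding Cauchy_convergent_iff[symmetric]
    proof (rule CauchyI')
      fix e :: real assume "0 < e"
      \<comment> \<open>Half of \<open>e\<close>, because two later partial sums are compared
        through the same reference index \<open>m\<close>.\<close>
      then obtain j where j: "1 / real (Suc j) < e / 2"
        using nat_approx_posE[of "e / 2"] by auto
      obtain m where m: "\<And>k. m \<le> k \<Longrightarrow> \<bar>(\<Sum>t<k. D t \<omega>) - (\<Sum>t<m. D t \<omega>)\<bar> < 1 / real (Suc j)"
        using * by blast
      have "dist (\<Sum>t<a. D t \<omega>) (\<Sum>t<b. D t \<omega>) < e" if "m \<le> a" "a < b" for a b
        using m[of a] m[of b] that j by (simp add: dist_real_def)
      then show "\<exists>m. \<forall>a\<ge>m. \<forall>b>a. dist (\<Sum>t<a. D t \<omega>) (\<Sum>t<b. D t \<omega>) < e" by blast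
    qed
  qed
qed

end

section \<open>Strong laws along predictable visit times\<close>

context filtered_prob_space
begin

text \<open>Bridge from the transition law, given as the conditional expectation of an indicator, to
  the integral form of \<open>mart_diff\<close>: a function of the past may be moved inside the
  conditional expectation.\<close>

lemma mart_diff_cond_prob:
  assumes A: "\<And>t. A t \<in> sets (F (Suc t))"
    and p: "\<And>t. p t \<in> borel_measurable (F t)" "\<And>t. bounded_on_space (p t)"
    and ce: "\<And>t. AE \<omega> in M. real_cond_exp M (F t) (indicat_real (A t)) \<omega> = p t \<omega>"
  shows "mart_diff (\<lambda>t \<omega>. indicat_real (A t) \<omega> - p t \<omega>)"
  unfolding mart_diff_def
proof (intro allI conjI ballI impI)
  fix t
  interpret sigma_finite_subalgebra M "F t"
    by (intro finite_measure_subalgebra_is_sigma_finite finite_measure_subalgebra.intro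
        finite_measure_subalgebra_axioms.intro finite_measure_axioms subalgebra_F)
  have [measurable]: "A t \<in> sets M"
    using A[of t] subalgebra_F[of "Suc t"] unfolding subalgebra_def by blast
  have [measurable]: "p t \<in> borel_measurable M" using p(1) by (rule measurable_F_M)
  have ib: "bounded_on_space (indicat_real (A t))"
    by (rule bounded_on_spaceI[where C = 1]) simp
  show "(\<lambda>\<omega>. indicat_real (A t) \<omega> - p t \<omega>) \<in> borel_measurable (F (Suc t))"
    by (intro borel_measurable_diff borel_measurable_indicator A measurable_F_mono[OF p(1)]) simp
  have "bounded_on_space (\<lambda>\<omega>. indicat_real (A t) \<omega> + (-1) * p t \<omega>)"
    by (intro bounded_on_space_add bounded_on_space_mult ib p bounded_on_space_const)
  then show "bounded_on_space (\<lambda>\<omega>. indicat_real (A t) \<omega> - p t \<omega>)" by simp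
  fix g assume g: "g \<in> borel_measurable (F t)" "bounded_on_space g"
  have gM [measurable]: "g \<in> borel_measurable M" using g(1) by (rule measurable_F_M)
  have i1: "integrable M (\<lambda>\<omega>. g \<omega> * indicat_real (A t) \<omega>)"
    by (intro integrable_bounded_on_space bounded_on_space_mult ib g) measurable
  have i2: "integrable M (\<lambda>\<omega>. g \<omega> * p t \<omega>)"
    by (intro integrable_bounded_on_space bounded_on_space_mult p g) measurable
  have "(\<integral>\<omega>. g \<omega> * indicat_real (A t) \<omega> \<partial>M)
      = (\<integral>\<omega>. g \<omega> * real_cond_exp M (F t) (indicat_real (A t)) \<omega> \<partial>M)"
    by (rule real_cond_exp_intg(2)[symmetric, OF i1 g(1)]) measurable
  also have "\<dots> = (\<integral>\<omega>. g \<omega> * p t \<omega> \<partial>M)"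
  proof (rule integral_cong_AE)
    show "AE \<omega> in M. g \<omega> * real_cond_exp M (F t) (indicat_real (A t)) \<omega> = g \<omega> * p t \<omega>"
      using ce[of t] by eventually_elim simp
    show "(\<lambda>\<omega>. g \<omega> * real_cond_exp M (F t) (indicat_real (A t)) \<omega>) \<in> borel_measurable M"
      by (intro borel_measurable_times gM borel_measurable_cond_exp2)
  qed (rule borel_measurable_integrable[OF i2])
  finally show "(\<integral>\<omega>. g \<omega> * (indicat_real (A t) \<omega> - p t \<omega>) \<partial>M) = 0"
    using i1 i2 by (simp add: right_diff_distrib)
qed

end

locale predictable_visits = filtered_prob_space M F
  for M :: "'w measure" and F :: "nat \<Rightarrow> 'w measure" +
  fixes V :: "nat \<Rightarrow> 'w \<Rightarrow> bool"
  assumes V_measurable: "\<And>t. V t \<in> measurable (F t) (count_space UNIV)"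
begin

text \<open>Time \<open>t\<close> itself is counted, so at a visit this is its ordinal, starting
  from 1. It is still known at \<open>t\<close>, because whether \<open>t\<close> is a visit is
  decided before the next state and the noise are drawn.\<close>

definition visit_no :: "nat \<Rightarrow> 'w \<Rightarrow> nat"
  where "visit_no t \<omega> = count_before (\<lambda>s. V s \<omega>) (Suc t)"

lemma visit_no_le: "visit_no t \<omega> \<le> Suc t"
  by (simp add: visit_no_def count_before_le)

lemma visit_no_measurable: "visit_no t \<in> measurable (F t) (count_space UNIV)"
proof -
  have "(\<lambda>\<omega>. of_bool (V s \<omega>) :: nat) \<in> measurable (F t) (count_space UNIV)" if "s \<in> {..<Suc t}" for s
    by (rule measurable_compose[OF measurable_F_mono[OF V_measurable]]) (use that in auto)
  then show ?thesis
    unfolding visit_no_def[abs_def] count_before_eq_sum by (rule measurable_sum_nat)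
qed

lemma visit_no_fun_measurable:
  "(\<lambda>\<omega>. h (visit_no t \<omega>)) \<in> borel_measurable (F t)" for h :: "nat \<Rightarrow> real"
  by (rule measurable_compose[OF visit_no_measurable]) simp

lemma V_of_bool_measurable: "(\<lambda>\<omega>. of_bool (V t \<omega>) :: real) \<in> borel_measurable (F t)"
  by (rule measurable_compose[OF V_measurable]) simp

lemma visit_fun_measurable:
  "(\<lambda>\<omega>. of_bool (V t \<omega>) * h (visit_no t \<omega>)) \<in> borel_measurable (F t)" for h :: "nat \<Rightarrow> real"
  by (intro borel_measurable_times V_of_bool_measurable visit_no_fun_measurable)

lemma visit_no_fun_bounded: "bounded_on_space (\<lambda>\<omega>. h (visit_no t \<omega>))"
proof (rule bounded_on_spaceI)
  fix \<omega>
  have "\<bar>h (visit_no t \<omega>)\<bar> \<in> (\<lambda>k. \<bar>h k\<bar>) ` {..Suc t}" using visit_no_le by auto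
  then show "\<bar>h (visit_no t \<omega>)\<bar> \<le> Max ((\<lambda>k. \<bar>h k\<bar>) ` {..Suc t})" by (intro Max_ge) auto
qed

lemma visit_fun_bounded: "bounded_on_space (\<lambda>\<omega>. of_bool (V t \<omega>) * h (visit_no t \<omega>))"
  by (intro bounded_on_space_mult visit_no_fun_bounded bounded_on_spaceI[where C = 1]) simp

lemma visit_fun_integrable: "integrable M (\<lambda>\<omega>. of_bool (V t \<omega>) * h (visit_no t \<omega>))" for h :: "nat \<Rightarrow> real"
  by (intro integrable_bounded_on_space visit_fun_bounded measurable_F_M[OF visit_fun_measurable])

text \<open>The bound is pathwise: on every trajectory the terms picked up are \<open>h 1\<close>,
  \<open>h 2\<close>, ... in order, each once, so \<open>B\<close> bounds the sum whatever the visit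
  times are.\<close>

lemma summable_visit_fun:
  fixes h :: "nat \<Rightarrow> real"
  assumes h: "\<And>k. 0 \<le> h k" and B: "\<And>n. (\<Sum>k=1..n. h k) \<le> B"
  shows "summable (\<lambda>t. \<integral>\<omega>. of_bool (V t \<omega>) * h (visit_no t \<omega>) \<partial>M)"
proof (rule bounded_imp_summable)
  show "0 \<le> (\<integral>\<omega>. of_bool (V t \<omega>) * h (visit_no t \<omega>) \<partial>M)" for t
    by (intro Bochner_Integration.integral_nonneg) (simp add: h)
  fix n
  have "(\<Sum>t\<le>n. \<integral>\<omega>. of_bool (V t \<omega>) * h (visit_no t \<omega>) \<partial>M)
      = (\<integral>\<omega>. (\<Sum>t<Suc n. of_bool (V t \<omega>) * h (visit_no t \<omega>)) \<partial>M)"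
    unfolding lessThan_Suc_atMost using visit_fun_integrable
    by (intro Bochner_Integration.integral_sum[symmetric]) blast
  also have "\<dots> = (\<integral>\<omega>. (\<Sum>k=1..count_before (\<lambda>s. V s \<omega>) (Suc n). h k) \<partial>M)"
    unfolding visit_no_def by (simp only: sum_visits_reindex[of "\<lambda>s. V s _" h])
  also have "\<dots> \<le> (\<integral>\<omega>. B \<partial>M)"
  proof (intro integral_mono B)
    have "integrable M (\<lambda>\<omega>. \<Sum>t<Suc n. of_bool (V t \<omega>) * h (visit_no t \<omega>))"
      by (intro Bochner_Integration.integrable_sum visit_fun_integrable)
    then show "integrable M (\<lambda>\<omega>. \<Sum>k=1..count_before (\<lambda>s. V s \<omega>) (Suc n). h k)"
      unfolding visit_no_def by (simp only: sum_visits_reindex[of "\<lambda>s. V s _" h])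
  qed simp
  also have "\<dots> = B" by (simp add: prob_space)
  finally show "(\<Sum>t\<le>n. \<integral>\<omega>. of_bool (V t \<omega>) * h (visit_no t \<omega>) \<partial>M) \<le> B" .
qed

text \<open>Common core of the laws for transitions and for noise: \<open>h k\<close> bounds the
  variance contributed by the \<open>k\<close>-th visit after division by \<open>k\<close>.
  Summability gives convergence of the divided sums, and Kronecker's lemma converts it into a
  vanishing mean.\<close>

lemma visit_mean_mart_diff:
  assumes X: "mart_diff X"
    and h: "\<And>k. 0 \<le> h k" "\<And>n. (\<Sum>k=1..n. h k) \<le> B"
    and Xh: "\<And>t. (\<integral>\<omega>. (of_bool (V t \<omega>) * X t \<omega> / real (visit_no t \<omega>))\<^sup>2 \<partial>M)
      \<le> (\<integral>\<omega>. of_bool (V t \<omega>) * h (visit_no t \<omega>) \<partial>M)"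
  shows "AE \<omega> in M. filterlim (count_before (\<lambda>t. V t \<omega>)) at_top sequentially \<longrightarrow>
    (\<lambda>n. (\<Sum>t<n. of_bool (V t \<omega>) * X t \<omega>) / real (count_before (\<lambda>t. V t \<omega>) n)) \<longlonglongrightarrow> 0"
proof -
  have "mart_diff (\<lambda>t \<omega>. (of_bool (V t \<omega>) * (1 / real (visit_no t \<omega>))) * X t \<omega>)"
    by (intro mart_diff_predictable_mult X visit_fun_measurable visit_fun_bounded)
  then have D: "mart_diff (\<lambda>t \<omega>. of_bool (V t \<omega>) * X t \<omega> / real (visit_no t \<omega>))"
    by simp
  have "summable (\<lambda>t. \<integral>\<omega>. (of_bool (V t \<omega>) * X t \<omega> / real (visit_no t \<omega>))\<^sup>2 \<partial>M)"
    by (rule summable_comparison_test'[OF summable_visit_fun[OF h], of 0])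
      (use Xh in simp)
  from mart_diff_convergent_AE[OF D this] show ?thesis
  proof eventually_elim
    case (elim \<omega>)
    then show ?case unfolding visit_no_def by (intro impI visit_mean_kronecker)
  qed
qed

lemma visit_mean_bounded_mart_diff:
  assumes X: "mart_diff X" and C: "\<And>t \<omega>. \<bar>X t \<omega>\<bar> \<le> C"
  shows "AE \<omega> in M. filterlim (count_before (\<lambda>t. V t \<omega>)) at_top sequentially \<longrightarrow>
    (\<lambda>n. (\<Sum>t<n. of_bool (V t \<omega>) * X t \<omega>) / real (count_before (\<lambda>t. V t \<omega>) n)) \<longlonglongrightarrow> 0"
proof (rule visit_mean_mart_diff[OF X])
  show "0 \<le> C\<^sup>2 * (1 / (real k)\<^sup>2)" for k by simp
  show "(\<Sum>k=1..n. C\<^sup>2 * (1 / (real k)\<^sup>2)) \<le> C\<^sup>2 * 2" for n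
    unfolding sum_distrib_left[symmetric]
    by (rule mult_left_mono) (use sum_inverse_squares_tail_le[of 1 n] in simp_all)
  \<comment> \<open>Any time and point would do: a bound on an absolute value is
    nonnegative.\<close>
  have "0 \<le> C" using C[of undefined undefined] by linarith
  then have sq: "(X t \<omega>)\<^sup>2 \<le> C\<^sup>2" for t \<omega> using C[of t \<omega>] by (simp add: abs_le_square_iff[symmetric])
  show "(\<integral>\<omega>. (of_bool (V t \<omega>) * X t \<omega> / real (visit_no t \<omega>))\<^sup>2 \<partial>M)
      \<le> (\<integral>\<omega>. of_bool (V t \<omega>) * (C\<^sup>2 * (1 / (real (visit_no t \<omega>))\<^sup>2)) \<partial>M)" for t
  proof (rule integral_mono')
    show "integrable M (\<lambda>\<omega>. of_bool (V t \<omega>) * (C\<^sup>2 * (1 / (real (visit_no t \<omega>))\<^sup>2)))"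
      by (rule visit_fun_integrable)
    show "(of_bool (V t \<omega>) * X t \<omega> / real (visit_no t \<omega>))\<^sup>2
        \<le> of_bool (V t \<omega>) * (C\<^sup>2 * (1 / (real (visit_no t \<omega>))\<^sup>2))" for \<omega>
      using sq[of t \<omega>] by (cases "V t \<omega>") (simp_all add: power_divide divide_right_mono)
  qed simp
qed

end

section \<open>The strong law for noise with only a first moment\<close>

lemma sum_of_bool_less_abs_le:
  "(\<Sum>k=1..n. of_bool (real k < \<bar>x\<bar>)) \<le> \<bar>x\<bar>" for x :: real
proof (induction n)
  case (Suc n)
  show ?case
  proof (cases "real (Suc n) < \<bar>x\<bar>")
    case True
    have "(\<Sum>k=1..Suc n. of_bool (real k < \<bar>x\<bar>)) \<le> (\<Sum>k=1..Suc n. 1 :: real)"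
      by (rule sum_mono) simp
    then show ?thesis using True by simp
  next
    case False
    then show ?thesis using Suc by (simp only: sum.cl_ivl_Suc) simp
  qed
qed simp

text \<open>This replaces a second moment by a first: the truncation deletes all terms with k below
  the ceiling m of \<bar>x\<bar>, and the remaining inverse squares sum to at most 2 / m. After
  integration the truncated second moments divided by k^2 sum to at most twice the first absolute
  moment.\<close>

lemma sum_truncated_squares_le:
  "(\<Sum>k=1..n. x\<^sup>2 * of_bool (\<bar>x\<bar> \<le> real k) / (real k)\<^sup>2) \<le> 2 * \<bar>x\<bar>" for x :: real
proof (cases "x = 0")
  case False
  define m where "m = nat \<lceil>\<bar>x\<bar>\<rceil>"
  have m: "\<bar>x\<bar> \<le> real m" "0 < m" using False unfolding m_def by linarith+
  have "(\<Sum>k=1..n. x\<^sup>2 * of_bool (\<bar>x\<bar> \<le> real k) / (real k)\<^sup>2) = (\<Sum>k=m..n. x\<^sup>2 * (1 / (real k)\<^sup>2))"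
  proof (rule sum.mono_neutral_cong_right)
    show "\<forall>k\<in>{1..n} - {m..n}. x\<^sup>2 * of_bool (\<bar>x\<bar> \<le> real k) / (real k)\<^sup>2 = 0"
      unfolding m_def by (auto simp: not_le)
    show "x\<^sup>2 * of_bool (\<bar>x\<bar> \<le> real k) / (real k)\<^sup>2 = x\<^sup>2 * (1 / (real k)\<^sup>2)" if "k \<in> {m..n}" for k
    proof -
      have "\<bar>x\<bar> \<le> real k" using m(1) that by auto
      then show ?thesis by simp
    qed
  qed (use m in auto)
  also have "\<dots> \<le> x\<^sup>2 * (2 / real m)"
    unfolding sum_distrib_left[symmetric] by (intro mult_left_mono sum_inverse_squares_tail_le m) simp
  also have "\<dots> \<le> 2 * \<bar>x\<bar>"
  proof -
    have "x\<^sup>2 = \<bar>x\<bar> * \<bar>x\<bar>" by (simp add: power2_eq_square)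
    moreover have "\<bar>x\<bar> * \<bar>x\<bar> \<le> \<bar>x\<bar> * real m" using m by (intro mult_left_mono) auto
    ultimately show ?thesis using m(2) by (simp add: field_simps)
  qed
  finally show ?thesis .
qed simp

locale sampled_noise = predictable_visits M F V
  for M :: "'w measure" and F :: "nat \<Rightarrow> 'w measure" and V +
  fixes W :: "nat \<Rightarrow> 'w \<Rightarrow> real"
  assumes W_measurable: "\<And>t. W t \<in> borel_measurable (F (Suc t))"
    and W_indep: "\<And>t. indep_set (sets (F t)) (sets (vimage_algebra (space M) (W t) borel))"
    and W_law: "\<And>t. distr M borel (W t) = distr M borel (W 0)"
    and W_integrable: "integrable M (W 0)"
    and W_centered: "(\<integral>\<omega>. W 0 \<omega> \<partial>M) = 0"
begin

abbreviation "law \<equiv> distr M borel (W 0)"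

lemma W_measurable_M: "W t \<in> borel_measurable M"
  by (rule measurable_F_M[OF W_measurable])

sublocale law: prob_space law
  by (rule prob_space_distr) (rule W_measurable_M)

lemma law_prob_UNIV: "law.prob UNIV = 1"
  using law.prob_space by simp

lemma law_integral: "f \<in> borel_measurable borel \<Longrightarrow> (\<integral>\<omega>. f (W t \<omega>) \<partial>M) = (\<integral>x. f x \<partial>law)"
  for f :: "real \<Rightarrow> real"
  using integral_distr[OF W_measurable_M, of f t] W_law[of t] by simp

lemma law_integrable_id: "integrable law (\<lambda>x. x)"
  using W_integrable by (subst integrable_distr_eq) (auto intro: W_measurable_M)

lemma integral_indep_noise:
  assumes g: "g \<in> borel_measurable (F t)" "bounded_on_space g"
    and f: "f \<in> borel_measurable borel" "\<And>x. \<bar>f x\<bar> \<le> C"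
  shows "(\<integral>\<omega>. g \<omega> * f (W t \<omega>) \<partial>M) = (\<integral>\<omega>. g \<omega> \<partial>M) * (\<integral>x. f x \<partial>law)"
proof -
  have gM: "g \<in> borel_measurable M" using g(1) by (rule measurable_F_M)
  have fM: "(\<lambda>\<omega>. f (W t \<omega>)) \<in> borel_measurable M" by (rule measurable_compose[OF W_measurable_M f(1)])
  have "indep_var borel g borel (\<lambda>\<omega>. f (W t \<omega>))"
    unfolding indep_var_eq
  proof (intro conjI gM fM)
    have "sigma_sets (space M) {g -` A \<inter> space M |A. A \<in> sets borel} \<subseteq> sets (F t)"
      using measurable_sets[OF g(1)] sets.sigma_sets_subset[of "{g -` A \<inter> space M |A. A \<in> sets borel}" "F t"]
      by auto
    moreover have "sigma_sets (space M) {(\<lambda>\<omega>. f (W t \<omega>)) -` A \<inter> space M |A. A \<in> sets borel}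
        \<subseteq> sets (vimage_algebra (space M) (W t) borel)"
    proof -
      have "(\<lambda>\<omega>. f (W t \<omega>)) \<in> borel_measurable (vimage_algebra (space M) (W t) borel)"
        by (rule measurable_compose[OF measurable_vimage_algebra1 f(1)]) simp
      from measurable_sets[OF this] show ?thesis
        using sets.sigma_sets_subset[of "{(\<lambda>\<omega>. f (W t \<omega>)) -` A \<inter> space M |A. A \<in> sets borel}"
            "vimage_algebra (space M) (W t) borel"] by auto
    qed
    ultimately show "indep_set (sigma_sets (space M) {g -` A \<inter> space M |A. A \<in> sets borel})
        (sigma_sets (space M) {(\<lambda>\<omega>. f (W t \<omega>)) -` A \<inter> space M |A. A \<in> sets borel})"
      using W_indep[of t] unfolding indep_sets2_eq by blast
  qed
  moreover have "integrable M g" by (intro integrable_bounded_on_space gM g)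
  moreover have "integrable M (\<lambda>\<omega>. f (W t \<omega>))"
    by (intro integrable_bounded_on_space fM bounded_on_spaceI[OF f(2)])
  ultimately show ?thesis
    using law_integral[OF f(1)] by (simp add: indep_var_lebesgue_integral)
qed

text \<open>The level is random but known before the noise is drawn, and it takes only the values 0
  to \<open>Suc t\<close>. Splitting \<open>g\<close> according to the level leaves finitely many
  products at a fixed level, each of which factors by independence.\<close>

lemma integral_indep_noise_visit_no:
  assumes g: "g \<in> borel_measurable (F t)" "bounded_on_space g"
    and f: "\<And>k. f k \<in> borel_measurable borel" "\<And>k x. \<bar>f k x\<bar> \<le> C k"
  shows "integrable M (\<lambda>\<omega>. g \<omega> * f (visit_no t \<omega>) (W t \<omega>))"
    "(\<integral>\<omega>. g \<omega> * f (visit_no t \<omega>) (W t \<omega>) \<partial>M) = (\<integral>\<omega>. g \<omega> * (\<integral>x. f (visit_no t \<omega>) x \<partial>law) \<partial>M)"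
proof -
  define G where "G k \<omega> = g \<omega> * of_bool (visit_no t \<omega> = k)" for k \<omega>
  have G: "G k \<in> borel_measurable (F t)" "bounded_on_space (G k)" for k
    unfolding G_def using visit_no_fun_measurable[of "\<lambda>j. of_bool (j = k)"]
      visit_no_fun_bounded[of "\<lambda>j. of_bool (j = k)"]
    by (auto intro!: borel_measurable_times bounded_on_space_mult g)
  have split: "g \<omega> * \<phi> (visit_no t \<omega>) = (\<Sum>k\<le>Suc t. G k \<omega> * \<phi> k)" for \<omega> and \<phi> :: "nat \<Rightarrow> real"
  proof -
    have "(\<Sum>k\<le>Suc t. G k \<omega> * \<phi> k) = (\<Sum>k\<in>{visit_no t \<omega>}. G k \<omega> * \<phi> k)"
      by (rule sum.mono_neutral_right) (use visit_no_le[of t \<omega>] in \<open>auto simp: G_def\<close>)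
    then show ?thesis by (simp add: G_def)
  qed
  have int1: "integrable M (\<lambda>\<omega>. G k \<omega> * f k (W t \<omega>))" for k
    by (intro integrable_bounded_on_space borel_measurable_times bounded_on_space_mult G
        measurable_F_M[OF G(1)] measurable_compose[OF W_measurable_M f(1)] bounded_on_spaceI[OF f(2)])
  have int2: "integrable M (G k)" for k
    by (intro integrable_bounded_on_space G measurable_F_M[OF G(1)])
  show "integrable M (\<lambda>\<omega>. g \<omega> * f (visit_no t \<omega>) (W t \<omega>))"
    unfolding split[of _ "\<lambda>k. f k (W t _)"] using int1 by (intro Bochner_Integration.integrable_sum)
  have "(\<integral>\<omega>. g \<omega> * f (visit_no t \<omega>) (W t \<omega>) \<partial>M) = (\<Sum>k\<le>Suc t. \<integral>\<omega>. G k \<omega> * f k (W t \<omega>) \<partial>M)"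
    unfolding split[of _ "\<lambda>k. f k (W t _)"] using int1 by (intro Bochner_Integration.integral_sum)
  also have "\<dots> = (\<Sum>k\<le>Suc t. \<integral>\<omega>. G k \<omega> * (\<integral>x. f k x \<partial>law) \<partial>M)"
    using integral_indep_noise[OF G f] by simp
  also have "\<dots> = (\<integral>\<omega>. g \<omega> * (\<integral>x. f (visit_no t \<omega>) x \<partial>law) \<partial>M)"
    unfolding split[of _ "\<lambda>k. \<integral>x. f k x \<partial>law"] using int2
    by (intro Bochner_Integration.integral_sum[symmetric]) auto
  finally show "(\<integral>\<omega>. g \<omega> * f (visit_no t \<omega>) (W t \<omega>) \<partial>M)
      = (\<integral>\<omega>. g \<omega> * (\<integral>x. f (visit_no t \<omega>) x \<partial>law) \<partial>M)" .
qed

definition trunc :: "nat \<Rightarrow> real \<Rightarrow> real"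
  where "trunc k x = x * of_bool (\<bar>x\<bar> \<le> real k)"

text \<open>Truncation can destroy the zero mean. This drift is subtracted at each level and
  restored at the end, where it averages out because it tends to 0.\<close>

definition trunc_mean :: "nat \<Rightarrow> real"
  where "trunc_mean k = (\<integral>x. trunc k x \<partial>law)"

lemma trunc_measurable [measurable]: "trunc k \<in> borel_measurable borel"
  unfolding trunc_def by measurable

lemma trunc_bound: "\<bar>trunc k x\<bar> \<le> real k"
  by (simp add: trunc_def)

lemma trunc_integrable: "integrable law (trunc k)"
  by (rule law.integrable_const_bound[where B = "real k"]) (use trunc_bound in auto)

lemma trunc_mean_bound: "\<bar>trunc_mean k\<bar> \<le> real k"
proof -
  have "\<bar>trunc_mean k\<bar> \<le> (\<integral>x. \<bar>trunc k x\<bar> \<partial>law)"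
    unfolding trunc_mean_def by (rule integral_abs_bound)
  also have "\<dots> \<le> (\<integral>x. real k \<partial>law)"
    using trunc_integrable trunc_bound by (intro integral_mono) auto
  finally show ?thesis using law_prob_UNIV by simp
qed

lemma centered_trunc_bound: "\<bar>trunc k x - trunc_mean k\<bar> \<le> 2 * real k"
  using trunc_bound[of k x] trunc_mean_bound[of k] by linarith

lemma trunc_mean_tendsto_zero: "trunc_mean \<longlonglongrightarrow> 0"
proof -
  have "(\<lambda>k. \<integral>x. trunc k x \<partial>law) \<longlonglongrightarrow> (\<integral>x. x \<partial>law)"
  \<comment> \<open>The first absolute moment supplies the dominating function.\<close>
  proof (rule integral_dominated_convergence[where w = "\<lambda>x. \<bar>x\<bar>"])
    show "integrable law (\<lambda>x. \<bar>x\<bar>)" using law_integrable_id by simp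
    show "AE x in law. (\<lambda>k. trunc k x) \<longlonglongrightarrow> x"
    proof (intro AE_I2 tendsto_eventually)
      fix x
      show "\<forall>\<^sub>F k in sequentially. trunc k x = x"
        using eventually_ge_at_top[of "nat \<lceil>\<bar>x\<bar>\<rceil>"]
      proof eventually_elim
        case (elim k)
        then have "\<bar>x\<bar> \<le> real k" by linarith
        then show ?case by (simp add: trunc_def)
      qed
    qed
    show "AE x in law. norm (trunc k x) \<le> \<bar>x\<bar>" for k by (simp add: trunc_def)
  qed simp_all
  moreover have "(\<integral>x. x \<partial>law) = 0" using law_integral[of "\<lambda>x. x" 0] W_centered by simp
  ultimately show ?thesis by (simp add: trunc_mean_def[abs_def])
qed

text \<open>Given the past, the level is fixed and the noise still has its original law, so
  \<open>trunc_mean\<close> at that level is exactly the right centering.\<close>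

lemma mart_diff_truncated_noise:
  "mart_diff (\<lambda>t \<omega>. trunc (visit_no t \<omega>) (W t \<omega>) - trunc_mean (visit_no t \<omega>))"
  unfolding mart_diff_def
proof (intro allI conjI ballI impI)
  fix t
  have "visit_no t \<in> measurable (F (Suc t)) (count_space UNIV)"
    using visit_no_measurable by (rule measurable_F_mono) simp
  note [measurable] = this W_measurable
  show "(\<lambda>\<omega>. trunc (visit_no t \<omega>) (W t \<omega>) - trunc_mean (visit_no t \<omega>)) \<in> borel_measurable (F (Suc t))"
    unfolding trunc_def by measurable
  show "bounded_on_space (\<lambda>\<omega>. trunc (visit_no t \<omega>) (W t \<omega>) - trunc_mean (visit_no t \<omega>))"
  proof (rule bounded_on_spaceI)
    fix \<omega>
    have "real (visit_no t \<omega>) \<le> real (Suc t)" using visit_no_le by (simp only: of_nat_le_iff)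
    then show "\<bar>trunc (visit_no t \<omega>) (W t \<omega>) - trunc_mean (visit_no t \<omega>)\<bar> \<le> 2 * real (Suc t)"
      by (intro order_trans[OF centered_trunc_bound]) simp
  qed
  fix g assume g: "g \<in> borel_measurable (F t)" "bounded_on_space g"
  have "(\<integral>\<omega>. g \<omega> * (trunc (visit_no t \<omega>) (W t \<omega>) - trunc_mean (visit_no t \<omega>)) \<partial>M)
      = (\<integral>\<omega>. g \<omega> * (\<integral>x. trunc (visit_no t \<omega>) x - trunc_mean (visit_no t \<omega>) \<partial>law) \<partial>M)"
  proof (rule integral_indep_noise_visit_no[OF g])
    show "\<bar>trunc k x - trunc_mean k\<bar> \<le> 2 * real k" for k x
      by (rule centered_trunc_bound)
  qed measurable
  also have "\<dots> = 0"
    using trunc_integrable law_prob_UNIV by (simp add: trunc_mean_def[symmetric])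
  finally show "(\<integral>\<omega>. g \<omega> * (trunc (visit_no t \<omega>) (W t \<omega>) - trunc_mean (visit_no t \<omega>)) \<partial>M) = 0" .
qed

lemma visit_mean_truncated_noise:
  "AE \<omega> in M. filterlim (count_before (\<lambda>t. V t \<omega>)) at_top sequentially \<longrightarrow>
    (\<lambda>n. (\<Sum>t<n. of_bool (V t \<omega>) * (trunc (visit_no t \<omega>) (W t \<omega>) - trunc_mean (visit_no t \<omega>)))
      / real (count_before (\<lambda>t. V t \<omega>) n)) \<longlonglongrightarrow> 0"
proof (rule visit_mean_mart_diff[OF mart_diff_truncated_noise])
  define h where "h k = (\<integral>x. (trunc k x)\<^sup>2 / (real k)\<^sup>2 \<partial>law)" for k
  have sq_bound: "(trunc k x)\<^sup>2 \<le> (real k)\<^sup>2" for k x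
    using trunc_bound[of k x] by (simp add: abs_le_square_iff[symmetric])
  have sq_int: "integrable law (\<lambda>x. (trunc k x)\<^sup>2)" for k
    by (rule law.integrable_const_bound[where B = "(real k)\<^sup>2"]) (use sq_bound in auto)
  show "0 \<le> h k" for k unfolding h_def by (intro Bochner_Integration.integral_nonneg) simp
  show "(\<Sum>k=1..n. h k) \<le> 2 * (\<integral>x. \<bar>x\<bar> \<partial>law)" for n
  proof -
    have "(\<Sum>k=1..n. h k) = (\<integral>x. (\<Sum>k=1..n. (trunc k x)\<^sup>2 / (real k)\<^sup>2) \<partial>law)"
      unfolding h_def using sq_int by (intro Bochner_Integration.integral_sum[symmetric]) auto
    also have "\<dots> \<le> (\<integral>x. 2 * \<bar>x\<bar> \<partial>law)"
    proof (rule integral_mono)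
      show "integrable law (\<lambda>x. \<Sum>k=1..n. (trunc k x)\<^sup>2 / (real k)\<^sup>2)"
        using sq_int by (intro Bochner_Integration.integrable_sum) auto
      show "(\<Sum>k=1..n. (trunc k x)\<^sup>2 / (real k)\<^sup>2) \<le> 2 * \<bar>x\<bar>" for x

        proof -
          have "(trunc k x)\<^sup>2 = x\<^sup>2 * of_bool (\<bar>x\<bar> \<le> real k)" for k
            by (cases "\<bar>x\<bar> \<le> real k") (simp_all add: trunc_def)
          then show ?thesis using sum_truncated_squares_le[of x n] by (simp only:)
        qed
    qed (use law_integrable_id in simp)
    finally show ?thesis by simp
  qed
  fix t
  let ?c = "\<lambda>\<omega>. of_bool (V t \<omega>) * (1 / (real (visit_no t \<omega>))\<^sup>2)"
  have "(\<integral>\<omega>. (of_bool (V t \<omega>) * (trunc (visit_no t \<omega>) (W t \<omega>) - trunc_mean (visit_no t \<omega>))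
        / real (visit_no t \<omega>))\<^sup>2 \<partial>M)
      = (\<integral>\<omega>. ?c \<omega> * (trunc (visit_no t \<omega>) (W t \<omega>) - trunc_mean (visit_no t \<omega>))\<^sup>2 \<partial>M)"
    by (rule Bochner_Integration.integral_cong) (auto simp: power_divide)
  also have "\<dots> = (\<integral>\<omega>. ?c \<omega> * (\<integral>x. (trunc (visit_no t \<omega>) x - trunc_mean (visit_no t \<omega>))\<^sup>2 \<partial>law) \<partial>M)"
  proof (rule integral_indep_noise_visit_no[OF visit_fun_measurable visit_fun_bounded])
    fix k x
    have "\<bar>trunc k x - trunc_mean k\<bar> \<le> \<bar>2 * real k\<bar>"
      using centered_trunc_bound[of k x] by simp
    then show "\<bar>(trunc k x - trunc_mean k)\<^sup>2\<bar> \<le> (2 * real k)\<^sup>2"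
      by (simp only: abs_power2 abs_le_square_iff)
  qed measurable
  also have "\<dots> \<le> (\<integral>\<omega>. of_bool (V t \<omega>) * h (visit_no t \<omega>) \<partial>M)"
  proof (rule integral_mono)
    show "integrable M (\<lambda>\<omega>. ?c \<omega> * (\<integral>x. (trunc (visit_no t \<omega>) x - trunc_mean (visit_no t \<omega>))\<^sup>2 \<partial>law))"
      using visit_fun_integrable[of t "\<lambda>k. 1 / (real k)\<^sup>2 * (\<integral>x. (trunc k x - trunc_mean k)\<^sup>2 \<partial>law)"]
      by (simp add: mult.assoc)
    \<comment> \<open>Centering only lowers the second moment, so the truncated second moments in
      \<open>h\<close> suffice.\<close>
    have var: "(\<integral>x. (trunc k x - trunc_mean k)\<^sup>2 \<partial>law) \<le> (\<integral>x. (trunc k x)\<^sup>2 \<partial>law)" for k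
      unfolding trunc_mean_def
      using law.variance_eq[OF trunc_integrable sq_int] by simp
    show "?c \<omega> * (\<integral>x. (trunc (visit_no t \<omega>) x - trunc_mean (visit_no t \<omega>))\<^sup>2 \<partial>law)
        \<le> of_bool (V t \<omega>) * h (visit_no t \<omega>)" for \<omega>
      using var[of "visit_no t \<omega>"] by (auto simp: h_def intro!: divide_right_mono)
  qed (rule visit_fun_integrable)
  finally show "(\<integral>\<omega>. (of_bool (V t \<omega>) * (trunc (visit_no t \<omega>) (W t \<omega>) - trunc_mean (visit_no t \<omega>))
        / real (visit_no t \<omega>))\<^sup>2 \<partial>M)
      \<le> (\<integral>\<omega>. of_bool (V t \<omega>) * h (visit_no t \<omega>) \<partial>M)" .
qed

text \<open>Borel-Cantelli: the \<open>k\<close>-th visit carries noise beyond \<open>k\<close> with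
  probability \<open>q k\<close>. The integers k >= 1 below \<bar>x\<bar> number at most
  \<bar>x\<bar>, so these probabilities sum to at most the first absolute moment.\<close>

lemma eventually_noise_not_truncated:
  "AE \<omega> in M. \<forall>\<^sub>F t in sequentially. V t \<omega> \<longrightarrow> \<bar>W t \<omega>\<bar> \<le> real (visit_no t \<omega>)"
proof -
  define q :: "nat \<Rightarrow> real" where "q k = (\<integral>x. of_bool (real k < \<bar>x\<bar>) \<partial>law)" for k :: nat
  let ?A = "\<lambda>t. {\<omega>\<in>space M. V t \<omega> \<and> real (visit_no t \<omega>) < \<bar>W t \<omega>\<bar>}"
  have mM: "V t \<in> measurable M (count_space UNIV)" "visit_no t \<in> measurable M (count_space UNIV)" for t
    by (rule measurable_F_M[OF V_measurable] measurable_F_M[OF visit_no_measurable])+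
  note [measurable] = mM W_measurable_M
  have ob_int: "integrable law (\<lambda>x. of_bool (real k < \<bar>x\<bar>) :: real)" for k
    by (rule law.integrable_const_bound[where B = 1]) auto
  have A: "?A t \<in> sets M" for t by measurable
  have prob_A: "prob (?A t) = (\<integral>\<omega>. of_bool (V t \<omega>) * q (visit_no t \<omega>) \<partial>M)" for t
  proof -
    have "prob (?A t) = (\<integral>\<omega>. indicat_real (?A t) \<omega> \<partial>M)" using A by simp
    also have "\<dots> = (\<integral>\<omega>. of_bool (V t \<omega>) * of_bool (real (visit_no t \<omega>) < \<bar>W t \<omega>\<bar>) \<partial>M)"
      by (rule Bochner_Integration.integral_cong) (auto simp: indicator_def)
    also have "\<dots> = (\<integral>\<omega>. of_bool (V t \<omega>) * q (visit_no t \<omega>) \<partial>M)"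
      unfolding q_def
      by (rule integral_indep_noise_visit_no(2)[where C = "\<lambda>_. 1"])
        (auto intro: V_of_bool_measurable bounded_on_spaceI[where C = 1])
    finally show ?thesis .
  qed
  have "summable (\<lambda>t. prob (?A t))"
    unfolding prob_A
  proof (rule summable_visit_fun)
    show "0 \<le> q k" for k unfolding q_def by (intro Bochner_Integration.integral_nonneg) simp
    show "(\<Sum>k=1..n. q k) \<le> (\<integral>x. \<bar>x\<bar> \<partial>law)" for n
    proof -
      have "(\<Sum>k=1..n. q k) = (\<integral>x. (\<Sum>k=1..n. of_bool (real k < \<bar>x\<bar>)) \<partial>law)"
        unfolding q_def using ob_int by (intro Bochner_Integration.integral_sum[symmetric])
      also have "\<dots> \<le> (\<integral>x. \<bar>x\<bar> \<partial>law)"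
        using law_integrable_id ob_int sum_of_bool_less_abs_le
        by (intro integral_mono Bochner_Integration.integrable_sum) auto
      finally show ?thesis .
    qed
  qed
  from borel_cantelli_AE1[OF A _ this]
  have "AE \<omega> in M. \<forall>\<^sub>F t in sequentially. \<omega> \<in> space M - ?A t"
    by (simp add: emeasure_eq_measure)
  then show ?thesis
  proof eventually_elim
    case (elim \<omega>)
    then show ?case by (rule eventually_mono) auto
  qed
qed

theorem visit_mean_noise:
  "AE \<omega> in M. filterlim (count_before (\<lambda>t. V t \<omega>)) at_top sequentially \<longrightarrow>
    (\<lambda>n. (\<Sum>t<n. of_bool (V t \<omega>) * W t \<omega>) / real (count_before (\<lambda>t. V t \<omega>) n)) \<longlonglongrightarrow> 0"
  using visit_mean_truncated_noise eventually_noise_not_truncated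
proof eventually_elim
  case (elim \<omega>)
  show ?case
  proof
    assume N: "filterlim (count_before (\<lambda>t. V t \<omega>)) at_top sequentially"
    let ?N = "\<lambda>n. real (count_before (\<lambda>t. V t \<omega>) n)"
    let ?X = "\<lambda>t. trunc (visit_no t \<omega>) (W t \<omega>) - trunc_mean (visit_no t \<omega>)"
    let ?e = "\<lambda>t. of_bool (V t \<omega> \<and> \<not> \<bar>W t \<omega>\<bar> \<le> real (visit_no t \<omega>)) * W t \<omega>"
    have 1: "(\<lambda>n. (\<Sum>t<n. of_bool (V t \<omega>) * ?X t) / ?N n) \<longlonglongrightarrow> 0"
      using elim(1) N by blast
    have "filterlim (\<lambda>t. visit_no t \<omega>) at_top sequentially"
      unfolding visit_no_def using N by (rule filterlim_compose[OF _ filterlim_Suc])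
    then have "(\<lambda>t. trunc_mean (visit_no t \<omega>)) \<longlonglongrightarrow> 0"
      by (rule filterlim_compose[OF trunc_mean_tendsto_zero])
    then have 2: "(\<lambda>n. (\<Sum>t<n. of_bool (V t \<omega>) * trunc_mean (visit_no t \<omega>)) / ?N n) \<longlonglongrightarrow> 0"
      by (rule visit_mean_tendsto_zero[OF N])
    have "?e \<longlonglongrightarrow> 0"
      by (rule tendsto_eventually) (use elim(2) in \<open>auto elim: eventually_mono\<close>)
    then have 3: "(\<lambda>n. (\<Sum>t<n. of_bool (V t \<omega>) * ?e t) / ?N n) \<longlonglongrightarrow> 0"
      by (rule visit_mean_tendsto_zero[OF N])
    \<comment> \<open>Three parts that average out for different reasons: centered truncated noise
      by martingale convergence, the truncation means because they tend to 0, and the excesses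
      because only finitely many are nonzero.\<close>
    have eq: "of_bool (V t \<omega>) * W t \<omega> = of_bool (V t \<omega>) * ?X t
        + of_bool (V t \<omega>) * trunc_mean (visit_no t \<omega>) + of_bool (V t \<omega>) * ?e t" for t
      by (simp add: trunc_def)
    have "(\<lambda>n. (\<Sum>t<n. of_bool (V t \<omega>) * W t \<omega>) / ?N n)
        = (\<lambda>n. (\<Sum>t<n. of_bool (V t \<omega>) * ?X t) / ?N n
          + (\<Sum>t<n. of_bool (V t \<omega>) * trunc_mean (visit_no t \<omega>)) / ?N n
          + (\<Sum>t<n. of_bool (V t \<omega>) * ?e t) / ?N n)"
      unfolding eq sum.distrib add_divide_distrib ..
    with tendsto_add[OF tendsto_add[OF 1 2] 3]
    show "(\<lambda>n. (\<Sum>t<n. of_bool (V t \<omega>) * W t \<omega>) / ?N n) \<longlonglongrightarrow> 0" by simp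
  qed
qed

end

section \<open>The Bellman optimality equation\<close>

lemma inner_prow: "prow p \<bullet> v = (\<Sum>x\<in>UNIV. pmf p x * v $ x)"
  by (simp add: prow_def inner_vec_def)

lemma sum_pmf_UNIV [simp]: "(\<Sum>x\<in>UNIV. pmf p x) = 1" for p :: "'a::finite pmf"
  by (rule sum_pmf_eq_1) auto

lemma finite_set_pmf_rollout: "finite (set_pmf (rollout P \<pi> i j n))"
  by (induction n) (auto simp: case_prod_beta)

text \<open>The definition extends a rollout at its end, whereas dynamic programming splits off the
  first transition. The rest is a rollout from the new pair under the policy that sees
  \<open>(i, j)\<close> in front of its history.\<close>

lemma rollout_Suc_first:
  "rollout P \<pi> i j (Suc n) =
    bind_pmf (P i j) (\<lambda>x'. bind_pmf (\<pi> [(i, j)] x') (\<lambda>u'.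
      map_pmf (\<lambda>(h, x, u). ((i, j) # h, x, u)) (rollout P (\<lambda>h. \<pi> ((i, j) # h)) x' u' n)))"
proof (induction n)
  case 0
  show ?case by (simp add: bind_return_pmf map_pmf_def)
next
  case (Suc n)
  have "rollout P \<pi> i j (Suc (Suc n)) =
     bind_pmf (rollout P \<pi> i j (Suc n)) (\<lambda>(h, x, u).
       bind_pmf (P x u) (\<lambda>x'. map_pmf (\<lambda>u'. (h @ [(x, u)], x', u')) (\<pi> (h @ [(x, u)]) x')))"
    by (rule rollout.simps(2))
  then show ?case
    unfolding Suc
    by (simp add: bind_assoc_pmf bind_map_pmf map_bind_pmf case_prod_beta pmf.map_comp o_def)
qed

lemma rollout_cong:
  assumes "(\<lambda>h. \<pi> ((i, j) # h)) = (\<lambda>h. \<pi>' ((i, j) # h))"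
  shows "rollout P \<pi> i j n = rollout P \<pi>' i j n"
proof (cases n)
  case (Suc m)
  have "\<pi> [(i, j)] = \<pi>' [(i, j)]" using assms by (rule fun_cong)
  then show ?thesis unfolding Suc rollout_Suc_first assms by simp
qed simp

lemma Q_policy_cong:
  "(\<lambda>h. \<pi> ((i, j) # h)) = (\<lambda>h. \<pi>' ((i, j) # h)) \<Longrightarrow> Q_policy P R \<gamma> \<pi> i j = Q_policy P R \<gamma> \<pi>' i j"
  unfolding Q_policy_def by (simp add: rollout_cong[of \<pi> i j \<pi>'])

context
  fixes P :: "'x::finite \<Rightarrow> 'u::finite \<Rightarrow> 'x pmf" and R :: "'x \<Rightarrow> 'u \<Rightarrow> real ^ 'x" and \<gamma> :: real
  assumes \<gamma>: "0 \<le> \<gamma>" "\<gamma> < 1"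
begin

private definition "stage_reward \<pi> i j n =
  measure_pmf.expectation (rollout P \<pi> i j n) (\<lambda>(h, x, u). prow (P x u) \<bullet> R x u)"

private definition "reward_bound = Max (range (\<lambda>(x, u). \<bar>prow (P x u) \<bullet> R x u\<bar>))"

private lemma reward_le_bound: "\<bar>prow (P x u) \<bullet> R x u\<bar> \<le> reward_bound"
  unfolding reward_bound_def by (rule Max_ge) (auto intro: image_eqI[of _ _ "(x, u)"])

private lemma abs_stage_reward_le: "\<bar>stage_reward \<pi> i j n\<bar> \<le> reward_bound"
proof -
  have "\<bar>stage_reward \<pi> i j n\<bar>
      \<le> measure_pmf.expectation (rollout P \<pi> i j n) (\<lambda>(h, x, u). \<bar>prow (P x u) \<bullet> R x u\<bar>)"
    unfolding stage_reward_def case_prod_beta by (rule integral_abs_bound)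
  also have "\<dots> \<le> measure_pmf.expectation (rollout P \<pi> i j n) (\<lambda>_. reward_bound)"
    using reward_le_bound
    by (intro integral_mono integrable_measure_pmf_finite finite_set_pmf_rollout)
      (auto simp: case_prod_beta)
  finally show ?thesis by simp
qed

private lemma summable_stage_reward: "summable (\<lambda>n. \<gamma> ^ n * stage_reward \<pi> i j n)"
proof (rule summable_comparison_test'[of "\<lambda>n. \<gamma> ^ n * reward_bound" 0])
  show "summable (\<lambda>n. \<gamma> ^ n * reward_bound)" using \<gamma> by (intro summable_mult2 summable_geometric) simp
  show "norm (\<gamma> ^ n * stage_reward \<pi> i j n) \<le> \<gamma> ^ n * reward_bound" for n
    using \<gamma> abs_stage_reward_le by (simp add: abs_mult mult_left_mono)
qed

private lemma Q_policy_eq: "Q_policy P R \<gamma> \<pi> i j = (\<Sum>n. \<gamma> ^ n * stage_reward \<pi> i j n)"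
  by (simp add: Q_policy_def stage_reward_def)

private lemma Q_policy_le: "Q_policy P R \<gamma> \<pi> i j \<le> reward_bound / (1 - \<gamma>)"
proof -
  have "Q_policy P R \<gamma> \<pi> i j \<le> (\<Sum>n. \<gamma> ^ n * reward_bound)"
    unfolding Q_policy_eq
  proof (intro suminf_le summable_stage_reward)
    show "\<gamma> ^ n * stage_reward \<pi> i j n \<le> \<gamma> ^ n * reward_bound" for n
      using \<gamma> abs_stage_reward_le[of \<pi> i j n] by (intro mult_left_mono) auto
    show "summable (\<lambda>n. \<gamma> ^ n * reward_bound)" using \<gamma> by (intro summable_mult2 summable_geometric) simp
  qed
  also have "\<dots> = (1 / (1 - \<gamma>)) * reward_bound"
    using \<gamma> by (subst suminf_mult2[symmetric]) (simp_all add: summable_geometric suminf_geometric)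
  finally show ?thesis by simp
qed

private lemma Q_policy_le_Q_opt: "Q_policy P R \<gamma> \<pi> i j \<le> Q_opt P R \<gamma> i j"
  unfolding Q_opt_def by (rule cSUP_upper) (auto intro: bdd_aboveI2 Q_policy_le)

private lemma stage_reward_Suc:
  "stage_reward \<pi> i j (Suc n) = (\<Sum>x'\<in>UNIV. pmf (P i j) x' *
    (\<Sum>u'\<in>UNIV. pmf (\<pi> [(i, j)] x') u' * stage_reward (\<lambda>h. \<pi> ((i, j) # h)) x' u' n))"
  unfolding stage_reward_def rollout_Suc_first case_prod_beta
  by (subst pmf_expectation_bind[of UNIV]; (simp add: finite_set_pmf_rollout)?)
    (subst pmf_expectation_bind[of UNIV]; simp add: finite_set_pmf_rollout case_prod_beta)

private lemma Q_policy_first_step: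
  "Q_policy P R \<gamma> \<pi> i j = prow (P i j) \<bullet> R i j + \<gamma> * (\<Sum>x'\<in>UNIV. pmf (P i j) x' *
    (\<Sum>u'\<in>UNIV. pmf (\<pi> [(i, j)] x') u' * Q_policy P R \<gamma> (\<lambda>h. \<pi> ((i, j) # h)) x' u'))"
proof -
  let ?\<pi> = "\<lambda>h. \<pi> ((i, j) # h)"
  have "Q_policy P R \<gamma> \<pi> i j
      = stage_reward \<pi> i j 0 + (\<Sum>n. \<gamma> ^ Suc n * stage_reward \<pi> i j (Suc n))"
    unfolding Q_policy_eq using suminf_split_head[OF summable_stage_reward, of \<pi> i j] by simp
  also have "stage_reward \<pi> i j 0 = prow (P i j) \<bullet> R i j"
    by (simp add: stage_reward_def)
  also have "(\<lambda>n. \<gamma> ^ Suc n * stage_reward \<pi> i j (Suc n))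
      = (\<lambda>n. \<gamma> * (\<Sum>x'\<in>UNIV. pmf (P i j) x' *
          (\<Sum>u'\<in>UNIV. pmf (\<pi> [(i, j)] x') u' * (\<gamma> ^ n * stage_reward ?\<pi> x' u' n))))"
    unfolding stage_reward_Suc by (simp add: sum_distrib_left mult_ac)
  also have "(\<Sum>n. \<gamma> * (\<Sum>x'\<in>UNIV. pmf (P i j) x' *
          (\<Sum>u'\<in>UNIV. pmf (\<pi> [(i, j)] x') u' * (\<gamma> ^ n * stage_reward ?\<pi> x' u' n))))
      = \<gamma> * (\<Sum>x'\<in>UNIV. pmf (P i j) x' *
          (\<Sum>u'\<in>UNIV. pmf (\<pi> [(i, j)] x') u' * Q_policy P R \<gamma> ?\<pi> x' u'))"
    unfolding Q_policy_eq
    by (intro sums_unique[symmetric] sums_mult sums_sum summable_sums summable_stage_reward)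
  finally show ?thesis .
qed

private lemma vmax_ge: "Q x u \<le> vmax Q $ x" for Q :: "'x \<Rightarrow> 'u \<Rightarrow> real"
  by (simp add: vmax_def)

text \<open>Upper bound: whatever follows the first transition is again a policy, hence worth at
  most the optimal value. Lower bound: near-optimal continuations for the possible next states are
  glued into one policy; working up to \<open>e\<close> avoids having to show that the supremum is
  attained.\<close>

theorem Q_opt_bellman: "Q_opt P R \<gamma> i j = prow (P i j) \<bullet> (R i j + \<gamma> *\<^sub>R v_opt P R \<gamma>)"
proof -
  have rhs: "prow (P i j) \<bullet> (R i j + \<gamma> *\<^sub>R v_opt P R \<gamma>)
      = prow (P i j) \<bullet> R i j + \<gamma> * (\<Sum>x'\<in>UNIV. pmf (P i j) x' * v_opt P R \<gamma> $ x')"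
    by (simp add: inner_add_right inner_prow)
  have upper: "Q_policy P R \<gamma> \<pi> i j
      \<le> prow (P i j) \<bullet> R i j + \<gamma> * (\<Sum>x'\<in>UNIV. pmf (P i j) x' * v_opt P R \<gamma> $ x')" for \<pi>
  proof -
    have "(\<Sum>u'\<in>UNIV. pmf (\<pi> [(i, j)] x') u' * Q_policy P R \<gamma> (\<lambda>h. \<pi> ((i, j) # h)) x' u')
        \<le> v_opt P R \<gamma> $ x'" for x'
    proof -
      have "(\<Sum>u'\<in>UNIV. pmf (\<pi> [(i, j)] x') u' * Q_policy P R \<gamma> (\<lambda>h. \<pi> ((i, j) # h)) x' u')
          \<le> (\<Sum>u'\<in>UNIV. pmf (\<pi> [(i, j)] x') u' * v_opt P R \<gamma> $ x')"
        by (intro sum_mono mult_left_mono order_trans[OF Q_policy_le_Q_opt vmax_ge]) simp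
      then show ?thesis by (simp add: sum_distrib_right[symmetric])
    qed
    then show ?thesis
      unfolding Q_policy_first_step[of \<pi>] using \<gamma>
      by (intro add_left_mono mult_left_mono sum_mono) auto
  qed
  have lower: "prow (P i j) \<bullet> R i j + \<gamma> * (\<Sum>x'\<in>UNIV. pmf (P i j) x' * v_opt P R \<gamma> $ x')
      \<le> Q_opt P R \<gamma> i j + e" if e: "0 < e" for e
  proof -
    have "\<exists>u \<pi>. v_opt P R \<gamma> $ x' - e < Q_policy P R \<gamma> \<pi> x' u" for x'
    proof -
      have "v_opt P R \<gamma> $ x' \<in> range (Q_opt P R \<gamma> x')"
        unfolding vmax_def by simp
      then obtain u where "v_opt P R \<gamma> $ x' = Q_opt P R \<gamma> x' u" by blast
      then have "v_opt P R \<gamma> $ x' - e < (SUP \<pi>. Q_policy P R \<gamma> \<pi> x' u)"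
        using e by (simp add: Q_opt_def)
      then obtain \<pi> where "v_opt P R \<gamma> $ x' - e < Q_policy P R \<gamma> \<pi> x' u"
        by (subst (asm) less_cSUP_iff) (auto intro: bdd_aboveI2 Q_policy_le)
      then show ?thesis by blast
    qed
    then obtain us pol where near: "\<And>x'. v_opt P R \<gamma> $ x' - e < Q_policy P R \<gamma> (pol x') x' (us x')"
      by metis
    \<comment> \<open>The first history entry is the starting pair and is dropped. The second one
      records the state entered, \<open>fst b\<close>, and so selects the continuation to follow. A
      history of length one calls for the chosen action \<open>us x\<close>; the empty history is
      never consulted by a rollout.\<close>
    define \<pi> :: "('x, 'u) policy" where "\<pi> h x =
      (case h of a # b # h' \<Rightarrow> pol (fst b) (b # h') x | _ \<Rightarrow> return_pmf (us x))" for h x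
    have "v_opt P R \<gamma> $ x' - e
        \<le> (\<Sum>u'\<in>UNIV. pmf (\<pi> [(i, j)] x') u' * Q_policy P R \<gamma> (\<lambda>h. \<pi> ((i, j) # h)) x' u')" for x'
    proof -
      have "Q_policy P R \<gamma> (\<lambda>h. \<pi> ((i, j) # h)) x' (us x') = Q_policy P R \<gamma> (pol x') x' (us x')"
        by (rule Q_policy_cong) (simp add: \<pi>_def fun_eq_iff)
      moreover have "(\<Sum>u'\<in>UNIV. pmf (\<pi> [(i, j)] x') u' * f u') = f (us x')" for f
      proof -
        have "(\<Sum>u'\<in>UNIV. pmf (\<pi> [(i, j)] x') u' * f u') = (\<Sum>u'\<in>{us x'}. pmf (\<pi> [(i, j)] x') u' * f u')"
          by (rule sum.mono_neutral_right) (auto simp: \<pi>_def)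
        then show ?thesis by (simp add: \<pi>_def)
      qed
      ultimately show ?thesis using near[of x'] by simp
    qed
    then have "(\<Sum>x'\<in>UNIV. pmf (P i j) x' * (v_opt P R \<gamma> $ x' - e))
        \<le> (\<Sum>x'\<in>UNIV. pmf (P i j) x' * (\<Sum>u'\<in>UNIV. pmf (\<pi> [(i, j)] x') u' *
            Q_policy P R \<gamma> (\<lambda>h. \<pi> ((i, j) # h)) x' u'))"
      by (intro sum_mono mult_left_mono) auto
    then have "\<gamma> * (\<Sum>x'\<in>UNIV. pmf (P i j) x' * (v_opt P R \<gamma> $ x' - e))
        \<le> Q_policy P R \<gamma> \<pi> i j - prow (P i j) \<bullet> R i j"
      unfolding Q_policy_first_step[of \<pi>] using \<gamma> by (simp add: mult_left_mono)
    moreover have "(\<Sum>x'\<in>UNIV. pmf (P i j) x' * (v_opt P R \<gamma> $ x' - e))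
        = (\<Sum>x'\<in>UNIV. pmf (P i j) x' * v_opt P R \<gamma> $ x') - e"
      by (simp add: right_diff_distrib sum_subtractf sum_distrib_right[symmetric])
    moreover have "\<gamma> * e \<le> e" using \<gamma> e by (simp add: mult_left_le_one_le)
    ultimately show ?thesis
      using Q_policy_le_Q_opt[of \<pi> i j] by (simp add: right_diff_distrib)
  qed
  show ?thesis
    unfolding rhs
    by (rule antisym[OF _ field_le_epsilon[OF lower]])
      (auto simp: Q_opt_def[of _ _ _ i j] intro!: cSUP_least upper)
qed

end

section \<open>Limits of the mean Bellman deviations\<close>

text \<open>Maximization over actions is nonexpansive in the sup norm, so an error bound on the
  Q-function carries over to the value vector.\<close>

lemma vmax_diff_le:
  assumes "\<And>x u. \<bar>Q x u - Q' x u\<bar> \<le> e"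
  shows "\<bar>vmax Q $ x - vmax Q' $ x\<bar> \<le> e"
proof -
  have le: "vmax f $ x \<le> vmax g $ x + e" if "\<And>x u. \<bar>f x u - g x u\<bar> \<le> e" for f g
  proof -
    have "f x u \<le> Max (range (g x)) + e" for u
    proof -
      have "g x u \<le> Max (range (g x))" by (rule Max_ge) auto
      then show ?thesis using that[of x u] by linarith
    qed
    then show ?thesis by (simp add: vmax_def)
  qed
  show ?thesis using le[of Q Q'] le[of Q' Q] assms by (simp add: abs_minus_commute abs_le_iff)
qed

lemma abs_inner_prow_le:
  assumes "\<And>x. \<bar>v $ x\<bar> \<le> e"
  shows "\<bar>prow p \<bullet> v\<bar> \<le> e"
proof -
  have "\<bar>prow p \<bullet> v\<bar> \<le> (\<Sum>x\<in>UNIV. pmf p x * \<bar>v $ x\<bar>)"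
    unfolding inner_prow by (rule order_trans[OF sum_abs]) (simp add: abs_mult)
  also have "\<dots> \<le> (\<Sum>x\<in>UNIV. pmf p x * e)"
    using assms by (intro sum_mono mult_left_mono) auto
  finally show ?thesis by (simp add: sum_distrib_right[symmetric])
qed

section \<open>Pathwise limit of the mean deviations\<close>

lemma card_visits: "card (visits D n i j \<omega>) = count_before (\<lambda>t. st D t \<omega> = i \<and> act D t \<omega> = j) n"
  by (simp add: visits_def count_before_def)

lemma visited_forever_iff:
  "visited_forever D i j \<omega> \<longleftrightarrow>
    filterlim (count_before (\<lambda>t. st D t \<omega> = i \<and> act D t \<omega> = j)) at_top sequentially"
  by (simp add: visited_forever_def card_visits)

lemma sum_visits:
  "(\<Sum>t\<in>visits D n i j \<omega>. f t) = (\<Sum>t<n. of_bool (st D t \<omega> = i \<and> act D t \<omega> = j) * f t)"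
  for f :: "nat \<Rightarrow> real"
proof -
  have "visits D n i j \<omega> = {..<n} \<inter> {t. st D t \<omega> = i \<and> act D t \<omega> = j}"
    by (auto simp: visits_def)
  then show ?thesis by simp
qed

lemma eventually_card_visits_pos:
  assumes "visited_forever D i j \<omega>"
  shows "\<forall>\<^sub>F n in sequentially. 0 < card (visits D n i j \<omega>)"
proof -
  have "\<forall>\<^sub>F n in sequentially. 1 \<le> card (visits D n i j \<omega>)"
    using assms unfolding visited_forever_def filterlim_at_top by blast
  then show ?thesis by eventually_elim simp
qed

definition dev_limit ::
  "('x::finite \<Rightarrow> 'u::finite \<Rightarrow> 'x pmf) \<Rightarrow> ('x \<Rightarrow> 'u \<Rightarrow> 'x pmf) \<Rightarrow> ('x \<Rightarrow> 'u \<Rightarrow> real ^ 'x) \<Rightarrow> real \<Rightarrow>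
    real \<Rightarrow> ('w, 'x, 'u) phase \<Rightarrow> 'x \<Rightarrow> 'u \<Rightarrow> 'w \<Rightarrow> real"
where
  "dev_limit P Phat R \<gamma> \<nu> D i j \<omega> =
     qhat D \<omega> i j - Q_opt P R \<gamma> i j
     + \<gamma> * (((1 - \<nu>) *\<^sub>R prow (P i j) + \<nu> *\<^sub>R prow (Phat i j)) \<bullet> (v_opt P R \<gamma> - vmax (qhat D \<omega>)))
     + \<nu> * value_drift P Phat R \<gamma> i j"

lemma dev_limit_secure:
  "dev_limit P Phat R \<gamma> 0 D i j = (\<lambda>\<omega>.
     qhat D \<omega> i j - Q_opt P R \<gamma> i j + \<gamma> * (prow (P i j) \<bullet> (v_opt P R \<gamma> - vmax (qhat D \<omega>))))"
  by (simp add: dev_limit_def fun_eq_iff)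

text \<open>The right side is the average deviation when next states follow the mixture row. The
  Bellman equation expresses \<open>Q_opt\<close> through the true row, and the mismatch between the
  two rows is what leaves the drift term.\<close>

lemma dev_limit_eq_mean:
  fixes P Phat :: "'x::finite \<Rightarrow> 'u::finite \<Rightarrow> 'x pmf"
  assumes \<gamma>: "0 \<le> \<gamma>" "\<gamma> < 1"
  shows "dev_limit P Phat R \<gamma> \<nu> D i j \<omega> =
    (\<Sum>x\<in>UNIV. (qhat D \<omega> i j - R i j $ x - \<gamma> * vmax (qhat D \<omega>) $ x) *
      (pmf (P i j) x + (pmf (Phat i j) x - pmf (P i j) x) * \<nu>))"
proof -
  let ?p = "prow (P i j)" and ?q = "prow (Phat i j)" and ?vh = "vmax (qhat D \<omega>)"
  have mean: "(\<Sum>x\<in>UNIV. (a - r $ x - \<gamma> * v $ x) * pmf p x) = a - prow p \<bullet> r - \<gamma> * (prow p \<bullet> v)"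
    for a and r v :: "real ^ 'x" and p
  proof -
    have "(\<Sum>x\<in>UNIV. (a - r $ x - \<gamma> * v $ x) * pmf p x)
        = (\<Sum>x\<in>UNIV. a * pmf p x) - (\<Sum>x\<in>UNIV. pmf p x * r $ x) - \<gamma> * (\<Sum>x\<in>UNIV. pmf p x * v $ x)"
      unfolding sum_distrib_left sum_subtractf[symmetric] by (rule sum.cong) (simp_all add: algebra_simps)
    then show ?thesis by (simp add: inner_prow flip: sum_distrib_left)
  qed
  have "(\<Sum>x\<in>UNIV. (qhat D \<omega> i j - R i j $ x - \<gamma> * ?vh $ x) *
      (pmf (P i j) x + (pmf (Phat i j) x - pmf (P i j) x) * \<nu>))
    = (1 - \<nu>) * (\<Sum>x\<in>UNIV. (qhat D \<omega> i j - R i j $ x - \<gamma> * ?vh $ x) * pmf (P i j) x)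
      + \<nu> * (\<Sum>x\<in>UNIV. (qhat D \<omega> i j - R i j $ x - \<gamma> * ?vh $ x) * pmf (Phat i j) x)"
    unfolding sum_distrib_left sum.distrib[symmetric]
    by (rule sum.cong) (simp, algebra)
  also have "\<dots> = dev_limit P Phat R \<gamma> \<nu> D i j \<omega>"
  proof -
    obtain v where v: "v = v_opt P R \<gamma>" by blast
    have Q: "Q_opt P R \<gamma> i j = ?p \<bullet> R i j + \<gamma> * (?p \<bullet> v)"
      unfolding v using Q_opt_bellman[OF \<gamma>, of P R i j] by (simp only: inner_add_right inner_scaleR_right)
    have drift: "value_drift P Phat R \<gamma> i j
        = ?p \<bullet> R i j + \<gamma> * (?p \<bullet> v) - (?q \<bullet> R i j + \<gamma> * (?q \<bullet> v))"
      unfolding value_drift_def v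
      by (simp only: inner_add_right inner_diff_left inner_scaleR_right right_diff_distrib)
    show ?thesis
      unfolding mean dev_limit_def Q drift v[symmetric] inner_add_left inner_diff_right inner_scaleR_left
      by (simp add: algebra_simps)
  qed
  finally show ?thesis ..
qed

lemma accurateD:
  assumes "accurate P R \<gamma> e D \<omega>"
  shows "\<bar>qhat D \<omega> i j - Q_opt P R \<gamma> i j\<bar> \<le> e"
    and "\<bar>prow p \<bullet> (v_opt P R \<gamma> - vmax (qhat D \<omega>))\<bar> \<le> e"
proof -
  show "\<bar>qhat D \<omega> i j - Q_opt P R \<gamma> i j\<bar> \<le> e" for i j
    using assms by (simp add: accurate_def)
  then have "\<bar>v_opt P R \<gamma> $ x - vmax (qhat D \<omega>) $ x\<bar> \<le> e" for x
    by (intro vmax_diff_le) (simp add: abs_minus_commute)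
  then show "\<bar>prow p \<bullet> (v_opt P R \<gamma> - vmax (qhat D \<omega>))\<bar> \<le> e"
    by (intro abs_inner_prow_le) simp
qed

text \<open>Origin of the threshold factor: the estimate at the pair contributes \<open>e\<close>,
  and a convex average of value errors, discounted, contributes \<open>\<gamma> * e\<close>.\<close>

lemma abs_dev_limit_minus_drift_le:
  assumes "accurate P R \<gamma> e D \<omega>" "0 \<le> \<gamma>" "0 \<le> \<nu>" "\<nu> \<le> 1"
  shows "\<bar>dev_limit P Phat R \<gamma> \<nu> D i j \<omega> - \<nu> * value_drift P Phat R \<gamma> i j\<bar> \<le> (1 + \<gamma>) * e"
proof -
  let ?d = "v_opt P R \<gamma> - vmax (qhat D \<omega>)"
  have "\<bar>((1 - \<nu>) *\<^sub>R prow (P i j) + \<nu> *\<^sub>R prow (Phat i j)) \<bullet> ?d\<bar>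
      \<le> (1 - \<nu>) * \<bar>prow (P i j) \<bullet> ?d\<bar> + \<nu> * \<bar>prow (Phat i j) \<bullet> ?d\<bar>"
    unfolding inner_add_left inner_scaleR_left
    by (rule order_trans[OF abs_triangle_ineq]) (use assms in \<open>simp add: abs_mult\<close>)
  also have "\<dots> \<le> (1 - \<nu>) * e + \<nu> * e"
    using assms by (intro add_mono mult_left_mono accurateD(2)) auto
  also have "\<dots> = e" by (simp add: algebra_simps)
  finally have "\<gamma> * \<bar>((1 - \<nu>) *\<^sub>R prow (P i j) + \<nu> *\<^sub>R prow (Phat i j)) \<bullet> ?d\<bar> \<le> \<gamma> * e"
    using assms by (intro mult_left_mono)
  then have "\<bar>\<gamma> * (((1 - \<nu>) *\<^sub>R prow (P i j) + \<nu> *\<^sub>R prow (Phat i j)) \<bullet> ?d)\<bar> \<le> \<gamma> * e"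
    using assms by (simp add: abs_mult)
  with accurateD(1)[OF assms(1), of i j] show ?thesis
    unfolding dev_limit_def by (simp add: distrib_right)
qed

lemma mean_dev_tendsto:
  fixes P Phat :: "'x::finite \<Rightarrow> 'u::finite \<Rightarrow> 'x pmf" and D :: "('w, 'x, 'u) phase"
    and i :: 'x and j :: 'u and \<omega> :: 'w
  assumes \<gamma>: "0 \<le> \<gamma>" "\<gamma> < 1"
  defines "N n \<equiv> real (card (visits D n i j \<omega>))"
    and "V t \<equiv> st D t \<omega> = i \<and> act D t \<omega> = j"
  assumes visited: "visited_forever D i j \<omega>"
    and trans: "\<And>x. (\<lambda>n. (\<Sum>t<n. of_bool (V t) *
        (of_bool (st D (Suc t) \<omega> = x) - pmf ((if atk D t \<omega> then Phat else P) (st D t \<omega>) (act D t \<omega>)) x)) / N n)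
        \<longlonglongrightarrow> 0"
    and noise: "(\<lambda>n. (\<Sum>t<n. of_bool (V t) * noise D t \<omega>) / N n) \<longlonglongrightarrow> 0"
    and frac: "(\<lambda>n. (\<Sum>t\<in>visits D n i j \<omega>. of_bool (atk D t \<omega>)) / N n) \<longlonglongrightarrow> \<nu>"
  shows "(\<lambda>n. mean_dev R \<gamma> D n i j \<omega>) \<longlonglongrightarrow> dev_limit P Phat R \<gamma> \<nu> D i j \<omega>"
proof -
  define c where "c x = qhat D \<omega> i j - R i j $ x - \<gamma> * vmax (qhat D \<omega>) $ x" for x
  define \<Delta> where "\<Delta> x = pmf (Phat i j) x - pmf (P i j) x" for x
  let ?T = "\<lambda>x n. (\<Sum>t<n. of_bool (V t) *
        (of_bool (st D (Suc t) \<omega> = x) - pmf ((if atk D t \<omega> then Phat else P) (st D t \<omega>) (act D t \<omega>)) x))"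
  let ?A = "\<lambda>n. \<Sum>t\<in>visits D n i j \<omega>. of_bool (atk D t \<omega>) :: real"
  let ?W = "\<lambda>n. \<Sum>t<n. of_bool (V t) * noise D t \<omega>"
  have A: "?A n = (\<Sum>t<n. of_bool (V t) * of_bool (atk D t \<omega>))" for n
    unfolding V_def by (rule sum_visits)
  have N: "N n = (\<Sum>t<n. of_bool (V t))" for n
    unfolding N_def V_def card_visits by (rule real_count_before)
  \<comment> \<open>At a visit the row in force is the true row plus \<open>\<Delta>\<close> times
    the attack indicator. Writing the next-state indicator as its centered version plus this row
    isolates the quantities whose visit means are known.\<close>
  have dev: "of_bool (V t) * bellman_dev R \<gamma> D t \<omega>
      = (\<Sum>x\<in>UNIV. c x * (of_bool (V t) * (of_bool (st D (Suc t) \<omega> = x)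
            - pmf ((if atk D t \<omega> then Phat else P) (st D t \<omega>) (act D t \<omega>)) x)
          + of_bool (V t) * pmf (P i j) x + \<Delta> x * (of_bool (V t) * of_bool (atk D t \<omega>))))
        - of_bool (V t) * noise D t \<omega>" for t
  proof (cases "V t")
    case True
    then have V: "st D t \<omega> = i" "act D t \<omega> = j" by (auto simp: V_def)
    have "(\<Sum>x\<in>UNIV. c x * (of_bool (V t) * (of_bool (st D (Suc t) \<omega> = x)
            - pmf ((if atk D t \<omega> then Phat else P) (st D t \<omega>) (act D t \<omega>)) x)
          + of_bool (V t) * pmf (P i j) x + \<Delta> x * (of_bool (V t) * of_bool (atk D t \<omega>))))
      = (\<Sum>x\<in>UNIV. c x * of_bool (st D (Suc t) \<omega> = x))"
      using True V by (intro sum.cong) (auto simp: \<Delta>_def)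
    also have "\<dots> = (\<Sum>x\<in>{st D (Suc t) \<omega>}. c x * of_bool (st D (Suc t) \<omega> = x))"
      by (rule sum.mono_neutral_right) auto
    finally show ?thesis using True V by (simp add: bellman_dev_def c_def Let_def)
  qed simp
  \<comment> \<open>The factor \<open>m / m\<close> is deliberately left uncancelled: it is 0 before
    the first visit and becomes 1 only eventually.\<close>
  have quotient: "((\<Sum>x\<in>UNIV. c x * (T x + m * pmf (P i j) x + \<Delta> x * a)) - w) / m
      = (\<Sum>x\<in>UNIV. c x * (T x / m + m / m * pmf (P i j) x + \<Delta> x * (a / m))) - w / m"
    for T :: "'x \<Rightarrow> real" and m a w :: real
    unfolding diff_divide_distrib sum_divide_distrib by (simp add: add_divide_distrib distrib_left)
  have "mean_dev R \<gamma> D n i j \<omega> = (\<Sum>x\<in>UNIV. c x * (?T x n / N n + N n / N n * pmf (P i j) x + \<Delta> x * (?A n / N n)))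
      - ?W n / N n" for n
  proof -
    have "(\<Sum>t\<in>visits D n i j \<omega>. bellman_dev R \<gamma> D t \<omega>)
        = (\<Sum>x\<in>UNIV. c x * (?T x n + N n * pmf (P i j) x + \<Delta> x * ?A n)) - ?W n"
      unfolding sum_visits V_def[symmetric] dev sum_subtractf A N
      by (subst sum.swap)
        (simp only: sum_distrib_left[symmetric] sum_distrib_right sum.distrib)
    then show ?thesis
      unfolding mean_dev_def N_def[symmetric]
      by (simp only: quotient)
  qed
  moreover have "(\<lambda>n. (\<Sum>x\<in>UNIV. c x * (?T x n / N n + N n / N n * pmf (P i j) x + \<Delta> x * (?A n / N n)))
      - ?W n / N n) \<longlonglongrightarrow> (\<Sum>x\<in>UNIV. c x * (0 + 1 * pmf (P i j) x + \<Delta> x * \<nu>)) - 0"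
  proof (intro tendsto_diff tendsto_sum tendsto_mult tendsto_add tendsto_const trans frac noise)
    have "\<forall>\<^sub>F n in sequentially. N n / N n = 1"
      using eventually_card_visits_pos[OF visited] by eventually_elim (simp add: N_def)
    then show "(\<lambda>n. N n / N n) \<longlonglongrightarrow> 1" by (rule tendsto_eventually)
  qed
  ultimately show ?thesis
    unfolding dev_limit_eq_mean[OF \<gamma>] c_def \<Delta>_def by simp
qed

section \<open>Retained pairs\<close>

text \<open>The visit counts add up to \<open>n\<close>, but if every pair were discarded they would
  add up to at most half of it.\<close>

lemma retained_nonempty:
  fixes D :: "('w, 'x::finite, 'u::finite) phase"
  assumes "0 < n"
  shows "retained D n \<omega> \<noteq> {}"
proof
  assume "retained D n \<omega> = {}"
  then have le: "real (card (visits D n i j \<omega>)) \<le> real n / (2 * real CARD('x) * real CARD('u))" for i j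
    unfolding retained_def by (force simp: not_less)
  have "(\<Union>p\<in>UNIV. visits D n (fst p) (snd p) \<omega>) = {..<n}"
    by (auto simp: visits_def)
  from arg_cong[OF this, of card]
  have "n = card (\<Union>p\<in>UNIV. visits D n (fst p) (snd p) \<omega>)" by simp
  also have "\<dots> \<le> (\<Sum>p\<in>UNIV. card (visits D n (fst p) (snd p) \<omega>))"
    by (rule card_UN_le) simp
  finally have "real n \<le> (\<Sum>p\<in>UNIV. real (card (visits D n (fst p) (snd p) \<omega>)))"
    by (simp only: of_nat_sum[symmetric] of_nat_le_iff)
  also have "\<dots> \<le> (\<Sum>p\<in>(UNIV :: ('x \<times> 'u) set). real n / (2 * real CARD('x) * real CARD('u)))"
    by (intro sum_mono le)
  also have "\<dots> = real n / 2" by (simp add: card_prod)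
  finally show False using assms by simp
qed

text \<open>A pair with bounded visit count falls below a threshold that grows linearly in
  \<open>n\<close>; finiteness of the set of pairs gives one horizon for all.\<close>

lemma eventually_retained_visited_forever:
  fixes D :: "('w, 'x::finite, 'u::finite) phase"
  shows "\<forall>\<^sub>F n in sequentially. \<forall>(i, j)\<in>retained D n \<omega>. visited_forever D i j \<omega>"
proof -
  have "\<forall>\<^sub>F n in sequentially. (i, j) \<in> retained D n \<omega> \<longrightarrow> visited_forever D i j \<omega>" for i j
  proof (cases "visited_forever D i j \<omega>")
    case False
    then obtain B where B: "\<not> (\<forall>\<^sub>F n in sequentially. B \<le> card (visits D n i j \<omega>))"
      unfolding visited_forever_def filterlim_at_top by blast
    \<comment> \<open>Counts are nondecreasing, so reaching \<open>B\<close> once would mean staying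
      above it eventually.\<close>
    have lt: "card (visits D n i j \<omega>) < B" for n
    proof (rule ccontr)
      assume "\<not> card (visits D n i j \<omega>) < B"
      then have "\<forall>m\<ge>n. B \<le> card (visits D m i j \<omega>)"
        unfolding card_visits by (meson count_before_mono le_trans not_less)
      then show False using B by (auto simp: eventually_sequentially)
    qed
    define k where "k = 2 * real CARD('x) * real CARD('u)"
    have k: "0 < k" by (simp add: k_def)
    have "\<forall>\<^sub>F n in sequentially. real B * k \<le> real n"
      using filterlim_real_sequentially unfolding filterlim_at_top by blast
    then show ?thesis
    proof eventually_elim
      case (elim n)
      have "real (card (visits D n i j \<omega>)) \<le> real B" using lt[of n] by simp
      also have "\<dots> \<le> real n / k" using elim k by (simp add: field_simps)
      finally show ?case by (simp add: retained_def k_def)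
    qed
  qed simp
  then have "\<forall>\<^sub>F n in sequentially. \<forall>p\<in>UNIV. p \<in> retained D n \<omega> \<longrightarrow> visited_forever D (fst p) (snd p) \<omega>"
    by (intro eventually_ball_finite) auto
  then show ?thesis by eventually_elim auto
qed

lemma breach_iff:
  assumes "0 < n"
  shows "breach R \<gamma> eb D n \<omega> \<longleftrightarrow>
    (\<exists>i j. (i, j) \<in> retained D n \<omega> \<and> (1 + \<gamma>) * eb < \<bar>mean_dev R \<gamma> D n i j \<omega>\<bar>)"
  unfolding breach_def using retained_nonempty[OF assms, of D \<omega>]
  by (subst Max_gr_iff) (simp_all, force)

text \<open>The retained pair that triggers the alarm may change with \<open>n\<close>, so all
  limits must exceed the threshold and one horizon must serve all pairs visited forever.\<close>

lemma eventually_breach: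
  fixes D :: "('w, 'x::finite, 'u::finite) phase"
  assumes lim: "\<And>i j. visited_forever D i j \<omega> \<Longrightarrow> (\<lambda>n. mean_dev R \<gamma> D n i j \<omega>) \<longlonglongrightarrow> L i j"
    and L: "\<And>i j. (1 + \<gamma>) * eb < \<bar>L i j\<bar>"
  shows "\<forall>\<^sub>F n in sequentially. breach R \<gamma> eb D n \<omega>"
proof -
  have "\<forall>\<^sub>F n in sequentially. \<forall>p\<in>UNIV. visited_forever D (fst p) (snd p) \<omega> \<longrightarrow>
      (1 + \<gamma>) * eb < \<bar>mean_dev R \<gamma> D n (fst p) (snd p) \<omega>\<bar>"
  proof (intro eventually_ball_finite ballI)
    fix p :: "'x \<times> 'u"
    show "\<forall>\<^sub>F n in sequentially. visited_forever D (fst p) (snd p) \<omega> \<longrightarrow>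
        (1 + \<gamma>) * eb < \<bar>mean_dev R \<gamma> D n (fst p) (snd p) \<omega>\<bar>"
    proof (cases "visited_forever D (fst p) (snd p) \<omega>")
      case True
      from order_tendstoD(1)[OF tendsto_rabs[OF lim[OF True]] L]
      show ?thesis by eventually_elim simp
    qed simp
  qed simp
  with eventually_retained_visited_forever[of D \<omega>] eventually_gt_at_top[of 0]
  show ?thesis
  proof eventually_elim
    case (elim n)
    obtain i j where "(i, j) \<in> retained D n \<omega>"
      using retained_nonempty[OF elim(2), of D \<omega>] by auto
    moreover have "visited_forever D i j \<omega>" using elim(1) calculation by blast
    ultimately show ?case
      using bspec[OF elim(3), of "(i, j)"] unfolding breach_iff[OF elim(2)] by auto
  qed
qed

lemma eventually_not_breach:
  fixes D :: "('w, 'x::finite, 'u::finite) phase"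
  assumes lim: "\<And>i j. visited_forever D i j \<omega> \<Longrightarrow> (\<lambda>n. mean_dev R \<gamma> D n i j \<omega>) \<longlonglongrightarrow> L i j"
    and L: "\<And>i j. \<bar>L i j\<bar> < (1 + \<gamma>) * eb"
  shows "\<forall>\<^sub>F n in sequentially. \<not> breach R \<gamma> eb D n \<omega>"
proof -
  have "\<forall>\<^sub>F n in sequentially. \<forall>p\<in>UNIV. visited_forever D (fst p) (snd p) \<omega> \<longrightarrow>
      \<bar>mean_dev R \<gamma> D n (fst p) (snd p) \<omega>\<bar> < (1 + \<gamma>) * eb"
  proof (intro eventually_ball_finite ballI)
    fix p :: "'x \<times> 'u"
    show "\<forall>\<^sub>F n in sequentially. visited_forever D (fst p) (snd p) \<omega> \<longrightarrow>
        \<bar>mean_dev R \<gamma> D n (fst p) (snd p) \<omega>\<bar> < (1 + \<gamma>) * eb"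
    proof (cases "visited_forever D (fst p) (snd p) \<omega>")
      case True
      from order_tendstoD(2)[OF tendsto_rabs[OF lim[OF True]] L]
      show ?thesis by eventually_elim simp
    qed simp
  qed simp
  with eventually_retained_visited_forever[of D \<omega>] eventually_gt_at_top[of 0]
  show ?thesis
  proof eventually_elim
    case (elim n)
    have "\<bar>mean_dev R \<gamma> D n i j \<omega>\<bar> < (1 + \<gamma>) * eb" if "(i, j) \<in> retained D n \<omega>" for i j
    proof -
      have "visited_forever D i j \<omega>" using elim(1) that by blast
      then show ?thesis using bspec[OF elim(3), of "(i, j)"] by simp
    qed
    then show ?case unfolding breach_iff[OF elim(2)] using less_asym by blast
  qed
qed

section \<open>Almost sure limits in a detection phase\<close>

locale monitored_phase =
  fixes P Phat :: "'x::finite \<Rightarrow> 'u::finite \<Rightarrow> 'x pmf"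
    and R :: "'x \<Rightarrow> 'u \<Rightarrow> real ^ 'x"
    and \<gamma> :: real
    and D :: "('w, 'x, 'u) phase"
  assumes \<gamma>: "0 \<le> \<gamma>" "\<gamma> < 1"
    and phase: "detection_phase P Phat D"
begin

lemma history: "history_ok D" and transitions: "transitions_ok P Phat D" and noise: "noise_ok D"
  using phase by (auto simp: detection_phase_def)

sublocale filtered_prob_space "pspace D" "hist D"
  using history
  by (intro filtered_prob_space.intro filtered_prob_space_axioms.intro) (auto simp: history_ok_def)

lemma hist_measurable:
  "st D t \<in> measurable (hist D t) (count_space UNIV)"
  "act D t \<in> measurable (hist D t) (count_space UNIV)"
  "atk D t \<in> measurable (hist D t) (count_space UNIV)"
  "noise D t \<in> borel_measurable (hist D (Suc t))"
  "(\<lambda>\<omega>. qhat D \<omega> x u) \<in> borel_measurable (hist D 0)"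
  using history by (auto simp: history_ok_def)

lemmas phase_measurable [measurable] = hist_measurable [THEN measurable_F_M]

lemma visit_measurable:
  "(\<lambda>\<omega>. st D t \<omega> = i \<and> act D t \<omega> = j) \<in> measurable (hist D t) (count_space UNIV)"
  using hist_measurable(1,2)[of t] by measurable

lemma predictable_visits: "predictable_visits (pspace D) (hist D) (\<lambda>t \<omega>. st D t \<omega> = i \<and> act D t \<omega> = j)"
  by unfold_locales (rule visit_measurable)

abbreviation "next_prob t \<omega> \<equiv> pmf ((if atk D t \<omega> then Phat else P) (st D t \<omega>) (act D t \<omega>))"

lemma next_prob_measurable: "(\<lambda>\<omega>. next_prob t \<omega> x) \<in> borel_measurable (hist D t)"
proof (rule measurable_compose_countable[OF _ hist_measurable(1)])
  fix i
  show "(\<lambda>\<omega>. pmf ((if atk D t \<omega> then Phat else P) i (act D t \<omega>)) x) \<in> borel_measurable (hist D t)"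
  proof (rule measurable_compose_countable[OF _ hist_measurable(2)])
    fix j
    show "(\<lambda>\<omega>. pmf ((if atk D t \<omega> then Phat else P) i j) x) \<in> borel_measurable (hist D t)"
      by (rule measurable_compose_countable[OF _ hist_measurable(3)]) simp
  qed
qed

lemma transition_mean:
  "AE \<omega> in pspace D. visited_forever D i j \<omega> \<longrightarrow>
    (\<lambda>n. (\<Sum>t<n. of_bool (st D t \<omega> = i \<and> act D t \<omega> = j) * (of_bool (st D (Suc t) \<omega> = x) - next_prob t \<omega> x))
      / real (card (visits D n i j \<omega>))) \<longlonglongrightarrow> 0"
proof -
  interpret predictable_visits "pspace D" "hist D" "\<lambda>t \<omega>. st D t \<omega> = i \<and> act D t \<omega> = j"
    by (rule predictable_visits)
  define A where "A t = {\<omega> \<in> space (pspace D). st D (Suc t) \<omega> = x}" for t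
  have "mart_diff (\<lambda>t \<omega>. indicat_real (A t) \<omega> - next_prob t \<omega> x)"
  proof (rule mart_diff_cond_prob)
    have "Measurable.pred (hist D (Suc t)) (\<lambda>\<omega>. st D (Suc t) \<omega> = x)" for t
      using hist_measurable(1)[of "Suc t"] by measurable
    from predE[OF this] show "A t \<in> sets (hist D (Suc t))" for t
      by (simp add: A_def)
    show "bounded_on_space (\<lambda>\<omega>. next_prob t \<omega> x)" for t
      by (rule bounded_on_spaceI[where C = 1]) (simp add: pmf_le_1)
    show "AE \<omega> in pspace D. real_cond_exp (pspace D) (hist D t) (indicat_real (A t)) \<omega> = next_prob t \<omega> x" for t
      using transitions unfolding transitions_ok_def A_def by blast
  qed (rule next_prob_measurable)
  moreover have "\<bar>indicat_real (A t) \<omega> - next_prob t \<omega> x\<bar> \<le> 1" for t \<omega>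
  proof -
    have "\<bar>a - b\<bar> \<le> 1" if "0 \<le> a" "a \<le> 1" "0 \<le> b" "b \<le> 1" for a b :: real
      using that by linarith
    from this[of "indicat_real (A t) \<omega>" "next_prob t \<omega> x"] show ?thesis
      by (simp only: indicator_pos_le indicator_le_1 pmf_nonneg pmf_le_1)
  qed
  ultimately have "AE \<omega> in pspace D. visited_forever D i j \<omega> \<longrightarrow>
    (\<lambda>n. (\<Sum>t<n. of_bool (st D t \<omega> = i \<and> act D t \<omega> = j) * (indicat_real (A t) \<omega> - next_prob t \<omega> x))
      / real (card (visits D n i j \<omega>))) \<longlonglongrightarrow> 0"
    unfolding visited_forever_iff card_visits by (rule visit_mean_bounded_mart_diff)
  from this AE_space show ?thesis
  proof eventually_elim
    case (elim \<omega>)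
    have "indicat_real (A t) \<omega> = of_bool (st D (Suc t) \<omega> = x)" for t
      using elim(2) by (simp add: A_def indicator_def)
    with elim(1) show ?case by (simp only:)
  qed
qed

lemma noise_mean:
  "AE \<omega> in pspace D. visited_forever D i j \<omega> \<longrightarrow>
    (\<lambda>n. (\<Sum>t<n. of_bool (st D t \<omega> = i \<and> act D t \<omega> = j) * noise D t \<omega>)
      / real (card (visits D n i j \<omega>))) \<longlonglongrightarrow> 0"
proof -
  interpret predictable_visits "pspace D" "hist D" "\<lambda>t \<omega>. st D t \<omega> = i \<and> act D t \<omega> = j"
    by (rule predictable_visits)
  interpret sampled_noise "pspace D" "hist D" "\<lambda>t \<omega>. st D t \<omega> = i \<and> act D t \<omega> = j" "noise D"
    by unfold_locales (use noise hist_measurable(4) in \<open>auto simp: noise_ok_def\<close>)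
  show ?thesis unfolding visited_forever_iff card_visits by (rule visit_mean_noise)
qed

lemma mean_dev_AE_tendsto:
  assumes frac: "\<And>i j. AE \<omega> in pspace D. visited_forever D i j \<omega> \<longrightarrow>
        (\<lambda>n. (\<Sum>t\<in>visits D n i j \<omega>. of_bool (atk D t \<omega>)) / real (card (visits D n i j \<omega>))) \<longlonglongrightarrow> \<nu>"
  shows "AE \<omega> in pspace D. \<forall>i j. visited_forever D i j \<omega> \<longrightarrow>
    (\<lambda>n. mean_dev R \<gamma> D n i j \<omega>) \<longlonglongrightarrow> dev_limit P Phat R \<gamma> \<nu> D i j \<omega>"
  unfolding AE_all_countable
proof (intro allI)
  fix i j
  have "AE \<omega> in pspace D. \<forall>x. visited_forever D i j \<omega> \<longrightarrow>
    (\<lambda>n. (\<Sum>t<n. of_bool (st D t \<omega> = i \<and> act D t \<omega> = j) * (of_bool (st D (Suc t) \<omega> = x) - next_prob t \<omega> x))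
      / real (card (visits D n i j \<omega>))) \<longlonglongrightarrow> 0"
    unfolding AE_all_countable by (intro allI transition_mean)
  with noise_mean[of i j] frac[of i j]
  show "AE \<omega> in pspace D. visited_forever D i j \<omega> \<longrightarrow>
    (\<lambda>n. mean_dev R \<gamma> D n i j \<omega>) \<longlonglongrightarrow> dev_limit P Phat R \<gamma> \<nu> D i j \<omega>"
    by eventually_elim (intro impI mean_dev_tendsto \<gamma>; blast)
qed

lemma mean_dev_AE_tendsto_secure:
  assumes "secure D"
  shows "AE \<omega> in pspace D. \<forall>i j. visited_forever D i j \<omega> \<longrightarrow>
    (\<lambda>n. mean_dev R \<gamma> D n i j \<omega>) \<longlonglongrightarrow> dev_limit P Phat R \<gamma> 0 D i j \<omega>"
  by (rule mean_dev_AE_tendsto) (use assms in \<open>auto simp: secure_def\<close>)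

lemma mean_dev_AE_tendsto_attack:
  assumes "dynamic_attack \<nu> D"
  shows "AE \<omega> in pspace D. \<forall>i j. visited_forever D i j \<omega> \<longrightarrow>
    (\<lambda>n. mean_dev R \<gamma> D n i j \<omega>) \<longlonglongrightarrow> dev_limit P Phat R \<gamma> \<nu> D i j \<omega>"
  by (rule mean_dev_AE_tendsto) (use assms in \<open>auto simp: dynamic_attack_def\<close>)

lemma attack_fraction_bounds:
  assumes "dynamic_attack \<nu> D"
  shows "0 \<le> \<nu>" "\<nu> \<le> 1"
proof -
  have "AE \<omega> in pspace D. (\<lambda>n. (\<Sum>t<n. of_bool (atk D t \<omega>)) / real n) \<longlonglongrightarrow> \<nu>"
    using assms by (simp add: dynamic_attack_def)
  then have "AE \<omega> in pspace D. 0 \<le> \<nu> \<and> \<nu> \<le> 1"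
  proof eventually_elim
    case (elim \<omega>)
    have "0 \<le> (\<Sum>t<n. of_bool (atk D t \<omega>)) / real n" for n
      by (intro divide_nonneg_nonneg sum_nonneg) auto
    moreover have "(\<Sum>t<n. of_bool (atk D t \<omega>)) / real n \<le> 1" for n
    proof -
      have "(\<Sum>t<n. of_bool (atk D t \<omega>)) \<le> (\<Sum>t<n. 1 :: real)" by (rule sum_mono) simp
      then show ?thesis by (cases "n = 0") (simp_all add: divide_le_eq_1)
    qed
    ultimately show ?case
      using LIMSEQ_le_const[OF elim, of 0] LIMSEQ_le_const2[OF elim, of 1] by blast
  qed
  \<comment> \<open>The assertion does not depend on \<omega>, and in a probability space a constant
    assertion that holds almost surely is true.\<close>
  then show "0 \<le> \<nu>" "\<nu> \<le> 1" by simp_all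
qed

section \<open>Measurability and high probability\<close>

lemma card_visits_measurable [measurable]:
  "(\<lambda>\<omega>. real (card (visits D n i j \<omega>))) \<in> borel_measurable (pspace D)"
  unfolding card_visits real_count_before by measurable

lemma qhat_measurable [measurable]: "(\<lambda>\<omega>. qhat D \<omega> x u) \<in> borel_measurable (pspace D)"
  by (rule phase_measurable)

lemma vmax_qhat_measurable [measurable]: "(\<lambda>\<omega>. vmax (qhat D \<omega>) $ x) \<in> borel_measurable (pspace D)"
  unfolding vmax_def vec_lambda_beta by (intro borel_measurable_Max) auto

text \<open>The estimate, rewards and values are indexed by random states and actions; fixing these
  countably valued indices one at a time leaves plainly measurable expressions.\<close>

lemma bellman_dev_measurable [measurable]: "bellman_dev R \<gamma> D t \<in> borel_measurable (pspace D)"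
  unfolding bellman_dev_def[abs_def] Let_def
proof (rule measurable_compose_countable[where g = "st D t" and
      f = "\<lambda>i \<omega>. qhat D \<omega> i (act D t \<omega>) - R i (act D t \<omega>) $ st D (Suc t) \<omega> - noise D t \<omega>
        - \<gamma> * vmax (qhat D \<omega>) $ st D (Suc t) \<omega>", OF _ phase_measurable(1)])
  fix i
  show "(\<lambda>\<omega>. qhat D \<omega> i (act D t \<omega>) - R i (act D t \<omega>) $ st D (Suc t) \<omega> - noise D t \<omega>
      - \<gamma> * vmax (qhat D \<omega>) $ st D (Suc t) \<omega>) \<in> borel_measurable (pspace D)"
  proof (rule measurable_compose_countable[where g = "act D t" and
        f = "\<lambda>j \<omega>. qhat D \<omega> i j - R i j $ st D (Suc t) \<omega> - noise D t \<omega>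
          - \<gamma> * vmax (qhat D \<omega>) $ st D (Suc t) \<omega>", OF _ phase_measurable(2)])
    fix j
    show "(\<lambda>\<omega>. qhat D \<omega> i j - R i j $ st D (Suc t) \<omega> - noise D t \<omega>
        - \<gamma> * vmax (qhat D \<omega>) $ st D (Suc t) \<omega>) \<in> borel_measurable (pspace D)"
      by (rule measurable_compose_countable[where g = "st D (Suc t)" and
            f = "\<lambda>x \<omega>. qhat D \<omega> i j - R i j $ x - noise D t \<omega> - \<gamma> * vmax (qhat D \<omega>) $ x",
            OF _ phase_measurable(1)]) measurable
  qed
qed

lemma mean_dev_measurable [measurable]: "(\<lambda>\<omega>. mean_dev R \<gamma> D n i j \<omega>) \<in> borel_measurable (pspace D)"
  unfolding mean_dev_def sum_visits by measurable

lemma accurate_measurable [measurable]: "Measurable.pred (pspace D) (accurate P R \<gamma> e D)"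
  unfolding accurate_def[abs_def] by measurable

lemma breach_measurable [measurable]: "Measurable.pred (pspace D) (breach R \<gamma> eb D n)"
proof (cases "n = 0")
  case True
  \<comment> \<open>At horizon 0 the maximum is over the empty set and its value is unspecified, but
    the event is still constant in \<omega>.\<close>
  have "retained D 0 \<omega> = {}" for \<omega> by (auto simp: retained_def visits_def)
  then show ?thesis unfolding True breach_def[abs_def] by simp
next
  case False
  then have "breach R \<gamma> eb D n = (\<lambda>\<omega>. \<exists>i j.
      real n / (2 * real CARD('x) * real CARD('u)) < real (card (visits D n i j \<omega>)) \<and>
      (1 + \<gamma>) * eb < \<bar>mean_dev R \<gamma> D n i j \<omega>\<bar>)"
    by (intro ext) (simp add: breach_iff retained_def)
  then show ?thesis by simp
qed

lemma dev_limit_measurable [measurable]: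
  "(\<lambda>\<omega>. dev_limit P Phat R \<gamma> \<nu> D i j \<omega>) \<in> borel_measurable (pspace D)"
  unfolding dev_limit_eq_mean[OF \<gamma>] by measurable

text \<open>If an event holds eventually on almost every path, its indicators tend to 1 almost
  surely, and dominated convergence moves the limit to the probabilities.\<close>

lemma whpI:
  assumes meas: "\<And>n. Measurable.pred (pspace D) (E n)"
    and ev: "AE \<omega> in pspace D. \<forall>\<^sub>F n in sequentially. E n \<omega>"
  shows "whp D E"
proof -
  let ?A = "\<lambda>n. {\<omega> \<in> space (pspace D). E n \<omega>}"
  have A: "?A n \<in> sets (pspace D)" for n using meas[of n] by (rule predE)
  have "(\<lambda>n. \<integral>\<omega>. indicat_real (?A n) \<omega> \<partial>pspace D) \<longlonglongrightarrow> (\<integral>\<omega>. 1 \<partial>pspace D)"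
  proof (rule integral_dominated_convergence[where w = "\<lambda>_. 1"])
    show "AE \<omega> in pspace D. (\<lambda>n. indicat_real (?A n) \<omega>) \<longlonglongrightarrow> 1"
      using ev AE_space
    proof eventually_elim
      case (elim \<omega>)
      then show ?case
        by (intro tendsto_eventually) (auto elim!: eventually_mono)
    qed
  qed (use A in \<open>auto simp: indicator_def\<close>)
  then show ?thesis using A by (simp add: whp_def prob_of_def prob_space)
qed

lemma whp_mono:
  assumes "whp D E" and meas: "\<And>n. Measurable.pred (pspace D) (E' n)"
    and imp: "\<And>n \<omega>. E n \<omega> \<Longrightarrow> E' n \<omega>"
  shows "whp D E'"
  unfolding whp_def
proof (rule tendsto_sandwich[OF _ _ assms(1)[unfolded whp_def] tendsto_const])
  have "prob_of D (E n) \<le> prob_of D (E' n)" for n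
    unfolding prob_of_def using imp by (intro finite_measure_mono predE meas) auto
  then show "\<forall>\<^sub>F n in sequentially. prob_of D (E n) \<le> prob_of D (E' n)" by simp
  show "\<forall>\<^sub>F n in sequentially. prob_of D (E' n) \<le> 1" by (simp add: prob_of_def)
qed

lemma whp_limit_mean_dev:
  assumes lim: "AE \<omega> in pspace D. \<forall>i j. visited_forever D i j \<omega> \<longrightarrow>
      (\<lambda>n. mean_dev R \<gamma> D n i j \<omega>) \<longlonglongrightarrow> dev_limit P Phat R \<gamma> \<nu> D i j \<omega>"
    and visited: "AE \<omega> in pspace D. visited_forever D i j \<omega>"
  shows "whp_limit D (\<lambda>n \<omega>. mean_dev R \<gamma> D n i j \<omega>) (dev_limit P Phat R \<gamma> \<nu> D i j)"
  unfolding whp_limit_def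
proof (intro allI impI whpI)
  fix \<delta> :: real assume \<delta>: "0 < \<delta>"
  show "AE \<omega> in pspace D. \<forall>\<^sub>F n in sequentially.
      \<bar>mean_dev R \<gamma> D n i j \<omega> - dev_limit P Phat R \<gamma> \<nu> D i j \<omega>\<bar> < \<delta>"
    using lim visited
  proof eventually_elim
    case (elim \<omega>)
    then have "(\<lambda>n. mean_dev R \<gamma> D n i j \<omega>) \<longlonglongrightarrow> dev_limit P Phat R \<gamma> \<nu> D i j \<omega>" by blast
    from tendstoD[OF this \<delta>] show ?case by (simp add: dist_real_def)
  qed
qed measurable

lemma whp_limit_secure:
  assumes "secure D" "AE \<omega> in pspace D. visited_forever D i j \<omega>"
  shows "whp_limit D (\<lambda>n \<omega>. mean_dev R \<gamma> D n i j \<omega>) (\<lambda>\<omega>. qhat D \<omega> i j - Q_opt P R \<gamma> i j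
    + \<gamma> * (prow (P i j) \<bullet> (v_opt P R \<gamma> - vmax (qhat D \<omega>))))"
  unfolding dev_limit_secure[of P Phat, symmetric]
  by (rule whp_limit_mean_dev[OF mean_dev_AE_tendsto_secure]) (rule assms)+

lemma whp_limit_attack:
  assumes "dynamic_attack \<nu> D" "AE \<omega> in pspace D. visited_forever D i j \<omega>"
  shows "whp_limit D (\<lambda>n \<omega>. mean_dev R \<gamma> D n i j \<omega>) (\<lambda>\<omega>. qhat D \<omega> i j - Q_opt P R \<gamma> i j
    + \<gamma> * (((1 - \<nu>) *\<^sub>R prow (P i j) + \<nu> *\<^sub>R prow (Phat i j)) \<bullet> (v_opt P R \<gamma> - vmax (qhat D \<omega>)))
    + \<nu> * value_drift P Phat R \<gamma> i j)"
  unfolding dev_limit_def[symmetric]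
  by (rule whp_limit_mean_dev[OF mean_dev_AE_tendsto_attack]) (rule assms)+

lemma whp_near_undisturbed_limit:
  assumes attack: "dynamic_attack \<nu> D"
    and visited: "AE \<omega> in pspace D. visited_forever D i j \<omega>" and \<delta>: "0 < \<delta>"
  shows "whp D (\<lambda>n \<omega>. accurate P R \<gamma> e D \<omega> \<longrightarrow>
      \<bar>mean_dev R \<gamma> D n i j \<omega>
        - (qhat D \<omega> i j - Q_opt P R \<gamma> i j
           + \<gamma> * (prow (P i j) \<bullet> (v_opt P R \<gamma> - vmax (qhat D \<omega>)))
           + \<nu> * value_drift P Phat R \<gamma> i j)\<bar>
      < 2 * \<gamma> * \<nu> * e + \<delta>)"
proof (rule whp_mono)
  show "whp D (\<lambda>n \<omega>. \<bar>mean_dev R \<gamma> D n i j \<omega> - dev_limit P Phat R \<gamma> \<nu> D i j \<omega>\<bar> < \<delta>)"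
    using whp_limit_mean_dev[OF mean_dev_AE_tendsto_attack[OF attack] visited] \<delta>
    by (simp add: whp_limit_def)
  show "Measurable.pred (pspace D) (\<lambda>\<omega>. accurate P R \<gamma> e D \<omega> \<longrightarrow>
      \<bar>mean_dev R \<gamma> D n i j \<omega>
        - (qhat D \<omega> i j - Q_opt P R \<gamma> i j
           + \<gamma> * (prow (P i j) \<bullet> (v_opt P R \<gamma> - vmax (qhat D \<omega>)))
           + \<nu> * value_drift P Phat R \<gamma> i j)\<bar>
      < 2 * \<gamma> * \<nu> * e + \<delta>)" for n
    unfolding inner_prow vector_minus_component by measurable
  fix n \<omega>
  assume near: "\<bar>mean_dev R \<gamma> D n i j \<omega> - dev_limit P Phat R \<gamma> \<nu> D i j \<omega>\<bar> < \<delta>"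
  show "accurate P R \<gamma> e D \<omega> \<longrightarrow>
      \<bar>mean_dev R \<gamma> D n i j \<omega>
        - (qhat D \<omega> i j - Q_opt P R \<gamma> i j
           + \<gamma> * (prow (P i j) \<bullet> (v_opt P R \<gamma> - vmax (qhat D \<omega>)))
           + \<nu> * value_drift P Phat R \<gamma> i j)\<bar>
      < 2 * \<gamma> * \<nu> * e + \<delta>"
  proof
    assume acc: "accurate P R \<gamma> e D \<omega>"
    let ?d = "v_opt P R \<gamma> - vmax (qhat D \<omega>)"
    let ?L = "qhat D \<omega> i j - Q_opt P R \<gamma> i j + \<gamma> * (prow (P i j) \<bullet> ?d) + \<nu> * value_drift P Phat R \<gamma> i j"
    \<comment> \<open>Only the row weighting the value error differs. Each of the two averages is at
      most \<open>e\<close> in absolute value, whence the factor 2.\<close>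
    have "dev_limit P Phat R \<gamma> \<nu> D i j \<omega> - ?L
        = \<gamma> * \<nu> * (prow (Phat i j) \<bullet> ?d - prow (P i j) \<bullet> ?d)"
    proof -
      have "q - z + \<gamma> * ((1 - \<nu>) * a + \<nu> * b) + c - (q - z + \<gamma> * a + c) = \<gamma> * \<nu> * (b - a)"
        for q z a b c :: real by algebra
      then show ?thesis unfolding dev_limit_def inner_add_left inner_scaleR_left .
    qed
    moreover have "\<bar>prow (Phat i j) \<bullet> ?d - prow (P i j) \<bullet> ?d\<bar> \<le> 2 * e"
      using accurateD(2)[OF acc, of "Phat i j"] accurateD(2)[OF acc, of "P i j"] by linarith
    then have "\<gamma> * \<nu> * \<bar>prow (Phat i j) \<bullet> ?d - prow (P i j) \<bullet> ?d\<bar> \<le> \<gamma> * \<nu> * (2 * e)"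
      using \<gamma> attack_fraction_bounds[OF attack] by (intro mult_left_mono) auto
    ultimately have "\<bar>dev_limit P Phat R \<gamma> \<nu> D i j \<omega> - ?L\<bar> \<le> 2 * \<gamma> * \<nu> * e"
      using \<gamma> attack_fraction_bounds[OF attack] by (simp add: abs_mult mult_ac)
    then show "\<bar>mean_dev R \<gamma> D n i j \<omega> - ?L\<bar> < 2 * \<gamma> * \<nu> * e + \<delta>"
      using near by linarith
  qed
qed

text \<open>At every pair the drift contributes more than two thresholds, and the estimation error
  can cancel at most one, so the limit stays strictly above the remaining one.\<close>

lemma whp_breach:
  assumes attack: "dynamic_attack \<nu> D" and e: "e \<le> eb"
    and adv: "2 * (1 + \<gamma>) * eb < \<nu> * min_value_drift P Phat R \<gamma>"
  shows "whp D (\<lambda>n \<omega>. accurate P R \<gamma> e D \<omega> \<longrightarrow> breach R \<gamma> eb D n \<omega>)"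
proof (rule whpI)
  note \<nu> = attack_fraction_bounds[OF attack]
  show "AE \<omega> in pspace D. \<forall>\<^sub>F n in sequentially. accurate P R \<gamma> e D \<omega> \<longrightarrow> breach R \<gamma> eb D n \<omega>"
    using mean_dev_AE_tendsto_attack[OF attack]
  proof eventually_elim
    case (elim \<omega>)
    show ?case
    proof (cases "accurate P R \<gamma> e D \<omega>")
      case acc: True
      have "(1 + \<gamma>) * eb < \<bar>dev_limit P Phat R \<gamma> \<nu> D i j \<omega>\<bar>" for i j
      proof -
        have "min_value_drift P Phat R \<gamma> \<le> \<bar>value_drift P Phat R \<gamma> i j\<bar>"
          unfolding min_value_drift_def by (rule Min_le) (auto intro: image_eqI[of _ _ "(i, j)"])
        then have "\<nu> * min_value_drift P Phat R \<gamma> \<le> \<bar>\<nu> * value_drift P Phat R \<gamma> i j\<bar>"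
          using \<nu> by (simp add: abs_mult mult_left_mono)
        moreover have "(1 + \<gamma>) * e \<le> (1 + \<gamma>) * eb" using e \<gamma> by (intro mult_left_mono) auto
        ultimately show ?thesis
          using abs_dev_limit_minus_drift_le[OF acc \<gamma>(1) \<nu>, of Phat i j] adv by linarith
      qed
      then have "\<forall>\<^sub>F n in sequentially. breach R \<gamma> eb D n \<omega>"
        using elim by (intro eventually_breach) auto
      then show ?thesis by eventually_elim simp
    qed simp
  qed
qed measurable

text \<open>Without attack the limit is at most \<open>(1 + \<gamma>) * e\<close>. The strict gap
  between \<open>e\<close> and \<open>eb\<close> leaves room for the fluctuations of the means
  around it.\<close>

lemma whp_no_breach:
  assumes secure: "secure D" and e: "e < eb"
  shows "whp D (\<lambda>n \<omega>. accurate P R \<gamma> e D \<omega> \<longrightarrow> \<not> breach R \<gamma> eb D n \<omega>)"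
proof (rule whpI)
  show "AE \<omega> in pspace D. \<forall>\<^sub>F n in sequentially. accurate P R \<gamma> e D \<omega> \<longrightarrow> \<not> breach R \<gamma> eb D n \<omega>"
    using mean_dev_AE_tendsto_secure[OF secure]
  proof eventually_elim
    case (elim \<omega>)
    show ?case
    proof (cases "accurate P R \<gamma> e D \<omega>")
      case acc: True
      have "\<bar>dev_limit P Phat R \<gamma> 0 D i j \<omega>\<bar> < (1 + \<gamma>) * eb" for i j
      proof -
        have "(1 + \<gamma>) * e < (1 + \<gamma>) * eb" using e \<gamma> by (intro mult_strict_left_mono) auto
        then show ?thesis
          using abs_dev_limit_minus_drift_le[OF acc \<gamma>(1), of 0 Phat i j] by simp
      qed
      then have "\<forall>\<^sub>F n in sequentially. \<not> breach R \<gamma> eb D n \<omega>"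
        using elim by (intro eventually_not_breach) auto
      then show ?thesis by eventually_elim simp
    qed simp
  qed
qed measurable

lemma prob_of_modus_ponens:
  assumes [measurable]: "Measurable.pred (pspace D) A" "Measurable.pred (pspace D) B"
  shows "prob_of D A + prob_of D (\<lambda>\<omega>. A \<omega> \<longrightarrow> B \<omega>) - 1 \<le> prob_of D B"
proof -
  let ?A = "{\<omega> \<in> space (pspace D). A \<omega>}" and ?I = "{\<omega> \<in> space (pspace D). A \<omega> \<longrightarrow> B \<omega>}"
    and ?B = "{\<omega> \<in> space (pspace D). B \<omega>}"
  have "prob ?A \<le> prob (?B \<union> (space (pspace D) - ?I))"
    by (rule finite_measure_mono) auto
  also have "\<dots> \<le> prob ?B + prob (space (pspace D) - ?I)"
    by (rule measure_Un_le) auto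
  also have "prob (space (pspace D) - ?I) = 1 - prob ?I"
    by (rule prob_compl) auto
  finally show ?thesis by (simp add: prob_of_def)
qed

text \<open>The failure budget \<eta> is split evenly: one half for an inaccurate estimate, fixed
  before detection, and one half for a finite horizon, which vanishes as \<open>n\<close>
  grows.\<close>

lemma eventually_prob_of_gt:
  assumes "whp D (\<lambda>n \<omega>. A \<omega> \<longrightarrow> E n \<omega>)" "1 - \<eta> / 2 < prob_of D A" "0 < \<eta>"
    and meas: "Measurable.pred (pspace D) A" "\<And>n. Measurable.pred (pspace D) (E n)"
  shows "\<forall>\<^sub>F n in sequentially. 1 - \<eta> < prob_of D (E n)"
proof -
  have "\<forall>\<^sub>F n in sequentially. 1 - \<eta> / 2 < prob_of D (\<lambda>\<omega>. A \<omega> \<longrightarrow> E n \<omega>)"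
    using assms(1,3) unfolding whp_def by (intro order_tendstoD(1)) auto
  then show ?thesis
  proof eventually_elim
    case (elim n)
    then show ?case using prob_of_modus_ponens[OF meas(1) meas(2)[of n]] assms(2) by linarith
  qed
qed

end

text \<open>The order of limits matters in the last two claims: for fixed training length the
  probability of an accurate estimate may stay below 1 however long detection lasts. Training is
  therefore made long first, and the horizon needed may depend on it.\<close>

theorem theorem9:
  fixes P Phat :: "'x::finite \<Rightarrow> 'u::finite \<Rightarrow> 'x pmf"
    and R :: "'x \<Rightarrow> 'u \<Rightarrow> real ^ 'x"
    and \<gamma> \<nu> eb :: real
    and err :: "nat \<Rightarrow> real"
    and D :: "nat \<Rightarrow> ('w, 'x, 'u) phase"
  assumes gamma: "0 \<le> \<gamma>" "\<gamma> < 1"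
    and phase: "\<And>ta. detection_phase P Phat (D ta)"
    and err_tendsto: "err \<longlonglongrightarrow> 0"
    and learned: "(\<lambda>ta. prob_of (D ta) (accurate P R \<gamma> (err ta) (D ta))) \<longlonglongrightarrow> 1"
    and over: "0 < eb" "\<And>ta. err ta \<le> eb"
  shows
    "(\<forall>ta. secure (D ta) \<longrightarrow>
       (\<forall>i j. (AE \<omega> in pspace (D ta). visited_forever (D ta) i j \<omega>) \<longrightarrow>
          whp_limit (D ta) (\<lambda>n \<omega>. mean_dev R \<gamma> (D ta) n i j \<omega>)
            (\<lambda>\<omega>. qhat (D ta) \<omega> i j - Q_opt P R \<gamma> i j
               + \<gamma> * (prow (P i j) \<bullet> (v_opt P R \<gamma> - vmax (qhat (D ta) \<omega>))))))
     \<and>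
     (\<forall>ta. dynamic_attack \<nu> (D ta) \<longrightarrow>
       (\<forall>i j. (AE \<omega> in pspace (D ta). visited_forever (D ta) i j \<omega>) \<longrightarrow>
          whp_limit (D ta) (\<lambda>n \<omega>. mean_dev R \<gamma> (D ta) n i j \<omega>)
            (\<lambda>\<omega>. qhat (D ta) \<omega> i j - Q_opt P R \<gamma> i j
               + \<gamma> * (((1 - \<nu>) *\<^sub>R prow (P i j) + \<nu> *\<^sub>R prow (Phat i j))
                        \<bullet> (v_opt P R \<gamma> - vmax (qhat (D ta) \<omega>)))
               + \<nu> * value_drift P Phat R \<gamma> i j)
          \<and> (\<forall>\<delta>>0. whp (D ta) (\<lambda>n \<omega>. accurate P R \<gamma> (err ta) (D ta) \<omega> \<longrightarrow>
               \<bar>mean_dev R \<gamma> (D ta) n i j \<omega>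
                  - (qhat (D ta) \<omega> i j - Q_opt P R \<gamma> i j
                     + \<gamma> * (prow (P i j) \<bullet> (v_opt P R \<gamma> - vmax (qhat (D ta) \<omega>)))
                     + \<nu> * value_drift P Phat R \<gamma> i j)\<bar>
               < 2 * \<gamma> * \<nu> * err ta + \<delta>))))
     \<and>
     (\<nu> * min_value_drift P Phat R \<gamma> > 2 * (1 + \<gamma>) * eb \<longrightarrow>
       (\<forall>ta. dynamic_attack \<nu> (D ta) \<longrightarrow>
          whp (D ta) (\<lambda>n \<omega>. accurate P R \<gamma> (err ta) (D ta) \<omega> \<longrightarrow> breach R \<gamma> eb (D ta) n \<omega>)) \<and>
       (\<forall>ta. secure (D ta) \<and> err ta < eb \<longrightarrow>
          whp (D ta) (\<lambda>n \<omega>. accurate P R \<gamma> (err ta) (D ta) \<omega> \<longrightarrow> \<not> breach R \<gamma> eb (D ta) n \<omega>)) \<and>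
       ((\<forall>ta. dynamic_attack \<nu> (D ta)) \<longrightarrow>
          (\<forall>\<eta>>0. \<forall>\<^sub>F ta in sequentially. \<forall>\<^sub>F n in sequentially.
             prob_of (D ta) (breach R \<gamma> eb (D ta) n) > 1 - \<eta>)) \<and>
       ((\<forall>ta. secure (D ta)) \<longrightarrow>
          (\<forall>\<eta>>0. \<forall>\<^sub>F ta in sequentially. \<forall>\<^sub>F n in sequentially.
             prob_of (D ta) (\<lambda>\<omega>. \<not> breach R \<gamma> eb (D ta) n \<omega>) > 1 - \<eta>)))"
proof -
  have mp: "monitored_phase P Phat \<gamma> (D ta)" for ta
    using gamma phase by unfold_locales
  have acc: "\<forall>\<^sub>F ta in sequentially. 1 - \<eta> / 2 < prob_of (D ta) (accurate P R \<gamma> (err ta) (D ta))"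
    if "0 < \<eta>" for \<eta> using learned that by (intro order_tendstoD(1)) auto
  have small: "\<forall>\<^sub>F ta in sequentially. err ta < eb"
    using err_tendsto over(1) by (rule order_tendstoD(2))
  have detect: "\<forall>\<^sub>F ta in sequentially. \<forall>\<^sub>F n in sequentially.
      prob_of (D ta) (breach R \<gamma> eb (D ta) n) > 1 - \<eta>"
    if adv: "\<nu> * min_value_drift P Phat R \<gamma> > 2 * (1 + \<gamma>) * eb"
      and attack: "\<forall>ta. dynamic_attack \<nu> (D ta)" and \<eta>: "0 < \<eta>" for \<eta>
    using acc[OF \<eta>]
  proof eventually_elim
    case (elim ta)
    interpret monitored_phase P Phat R \<gamma> "D ta" by (rule mp)
    show ?case
      by (rule eventually_prob_of_gt[OF whp_breach[OF _ over(2) adv] elim \<eta>]) (use attack in auto)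
  qed
  have no_alarm: "\<forall>\<^sub>F ta in sequentially. \<forall>\<^sub>F n in sequentially.
      prob_of (D ta) (\<lambda>\<omega>. \<not> breach R \<gamma> eb (D ta) n \<omega>) > 1 - \<eta>"
    if secure: "\<forall>ta. secure (D ta)" and \<eta>: "0 < \<eta>" for \<eta>
    using acc[OF \<eta>] small
  proof eventually_elim
    case (elim ta)
    interpret monitored_phase P Phat R \<gamma> "D ta" by (rule mp)
    show ?case
      by (rule eventually_prob_of_gt[OF whp_no_breach[OF _ elim(2)] elim(1) \<eta>]) (use secure in auto)
  qed
  show ?thesis
    by (intro conjI allI impI; (elim conjE)?; rule monitored_phase.whp_limit_secure[OF mp]
        monitored_phase.whp_limit_attack[OF mp] monitored_phase.whp_near_undisturbed_limit[OF mp]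
        monitored_phase.whp_breach[OF mp _ over(2)] monitored_phase.whp_no_breach[OF mp]
        detect no_alarm; assumption)
qed

end
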